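(* For a finite group $G$ the following are equivalent: (1) $G$ is nilpotent; (2) every abnormal subgroup of $G$ is $\mathrm{F}^*(G)$-subnormal; (3) the normalizers of all Sylow subgroups of $G$ are $\mathrm{F}^*(G)$-subnormal; (4) all cyclic primary subgroups of $G$ are $\mathrm{F}^*(G)$-subnormal; (5) all Sylow subgroups of $G$ are $\mathrm{F}^*(G)$-subnormal.
   Context: For a subgroup $R$ of $G$, a subgroup $H$ of $G$ is $R$-subnormal if $H$ is subnormal in $\langle H,R\rangle$. $\mathrm{F}^*(G)$ is the generalized Fitting subgroup (the largest normal quasinilpotent subgroup). A subgroup $H$ is abnormal in $G$ if $g\in\langle H,H^g\rangle$ for all $g\in G$. A cyclic primary subgroup is a cyclic subgroup of prime power order. *)

theory Defs
  imports "HOL-Algebra.Algebra" "HOL-Computational_Algebra.Primes"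
begin

definition comm_subgroup :: "('a, 'b) monoid_scheme \<Rightarrow> 'a set \<Rightarrow> 'a set \<Rightarrow> 'a set" where
  "comm_subgroup G A B = generate G
     (\<Union>a \<in> A. \<Union>b \<in> B. {a \<otimes>\<^bsub>G\<^esub> b \<otimes>\<^bsub>G\<^esub> inv\<^bsub>G\<^esub> a \<otimes>\<^bsub>G\<^esub> inv\<^bsub>G\<^esub> b})"

fun lower_central :: "('a, 'b) monoid_scheme \<Rightarrow> nat \<Rightarrow> 'a set" where
  "lower_central G 0 = carrier G"
| "lower_central G (Suc n) = comm_subgroup G (lower_central G n) (carrier G)"

definition nilpotent_group :: "('a, 'b) monoid_scheme \<Rightarrow> bool" where
  "nilpotent_group G \<longleftrightarrow> group G \<and> (\<exists>n. lower_central G n = {\<one>\<^bsub>G\<^esub>})"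

inductive subnormal_in :: "('a, 'b) monoid_scheme \<Rightarrow> 'a set \<Rightarrow> 'a set \<Rightarrow> bool"
  for G where
  refl: "subgroup K G \<Longrightarrow> subnormal_in G K K"
| step: "H \<lhd> (G\<lparr>carrier := L\<rparr>) \<Longrightarrow> subnormal_in G L K \<Longrightarrow> subnormal_in G H K"

definition R_subnormal :: "('a, 'b) monoid_scheme \<Rightarrow> 'a set \<Rightarrow> 'a set \<Rightarrow> bool" where
  "R_subnormal G R H \<longleftrightarrow> subnormal_in G H (generate G (H \<union> R))"

definition chief_factor :: "('a, 'b) monoid_scheme \<Rightarrow> 'a set \<Rightarrow> 'a set \<Rightarrow> bool" where
  "chief_factor G A B \<longleftrightarrow> A \<lhd> G \<and> B \<lhd> G \<and> B \<subset> A \<and>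
     (\<forall>N. N \<lhd> G \<longrightarrow> B \<subseteq> N \<longrightarrow> N \<subseteq> A \<longrightarrow> N = B \<or> N = A)"

definition section_centralizer :: "('a, 'b) monoid_scheme \<Rightarrow> 'a set \<Rightarrow> 'a set \<Rightarrow> 'a set" where
  "section_centralizer G A B = {g \<in> carrier G. \<forall>a \<in> A.
     a \<otimes>\<^bsub>G\<^esub> g \<otimes>\<^bsub>G\<^esub> inv\<^bsub>G\<^esub> a \<otimes>\<^bsub>G\<^esub> inv\<^bsub>G\<^esub> g \<in> B}"

text \<open>Quasinilpotent (Huppert--Blackburn X.13.1): every element of G induces an inner
  automorphism on every chief factor A/B, i.e. G = A C_G(A/B).\<close>
definition quasinilpotent :: "('a, 'b) monoid_scheme \<Rightarrow> bool" where
  "quasinilpotent G \<longleftrightarrow> group G \<and> (\<forall>A B. chief_factor G A B \<longrightarrow>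
     carrier G = A <#>\<^bsub>G\<^esub> section_centralizer G A B)"

text \<open>F*(G): the largest normal quasinilpotent subgroup, realised as the subgroup generated
  by all normal quasinilpotent subgroups (which is itself the largest one).\<close>
definition gen_fitting :: "('a, 'b) monoid_scheme \<Rightarrow> 'a set" where
  "gen_fitting G = generate G (\<Union>{N. N \<lhd> G \<and> quasinilpotent (G\<lparr>carrier := N\<rparr>)})"

definition abnormal :: "('a, 'b) monoid_scheme \<Rightarrow> 'a set \<Rightarrow> bool" where
  "abnormal G H \<longleftrightarrow> subgroup H G \<and>
     (\<forall>g \<in> carrier G. g \<in> generate G (H \<union> (inv\<^bsub>G\<^esub> g <#\<^bsub>G\<^esub> H #>\<^bsub>G\<^esub> g)))"

definition sylow_subgroup :: "('a, 'b) monoid_scheme \<Rightarrow> nat \<Rightarrow> 'a set \<Rightarrow> bool" where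
  "sylow_subgroup G p P \<longleftrightarrow> Factorial_Ring.prime p \<and> subgroup P G \<and>
     card P = p ^ multiplicity p (order G)"

definition cyclic_primary :: "('a, 'b) monoid_scheme \<Rightarrow> 'a set \<Rightarrow> bool" where
  "cyclic_primary G H \<longleftrightarrow> (\<exists>x \<in> carrier G. H = generate G {x}) \<and>
     (\<exists>p k. Factorial_Ring.prime (p::nat) \<and> card H = p ^ k)"

end

theory Submission
  imports Defs
begin

text \<open>Write F for the generalized Fitting subgroup. Each of the conditions (2)--(5) makes F normalize
  every Sylow subgroup of G: for (2) and (3) because normalizers of Sylow subgroups are abnormal and
  self-normalizing, and a self-normalizing subgroup that is subnormal in its join with F contains F;
  for (4) and (5) because a subnormal p-subgroup lies in every Sylow
  p-subgroup. It then follows that p-elements of G commute with q-elements of F for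
  \<open>p \<noteq> q\<close>, so the commutator of a p-element and a q-element of G centralizes F. Since
  F contains its own centralizer, such commutators normalize all Sylow subgroups, which forces every
  Sylow subgroup to be normal.

  To see that F contains its centralizer C, take otherwise a chief factor A/Z of G with
  \<open>Z = C \<inter> F\<close> and \<open>A \<subseteq> C\<close>. As Z is central in A and A/Z is a
  join of minimal normal subgroups, A is quasinilpotent and hence lies in F, a contradiction.\<close>

text \<open>The conditions only compare subgroups of G with F, so they give commutation between a
  p-element of G and a q-element of F, whereas nilpotency asks for it between two arbitrary elements
  of G. The commutator of a p-element x and a q-element y bridges this gap: any prime r differs from
  p or from q, so x or y commutes with every r-element of F, and the conjugations by the other one
  cancel. As F is generated by elements of prime power order, the commutator acts trivially on F. A
  commutator is shown to be trivial by placing it in a p-group and in a q-group at once. Condition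
  (4) is the delicate one, since it says nothing directly about a whole Sylow subgroup P. There the
  action of F on P is found prime by prime: p-elements of F lie in P, and r-elements of F with r
  different from p centralize P.\<close>

lemma (in group) mult_inv_cancel [simp]:
  assumes "x \<in> carrier G" "y \<in> carrier G"
  shows "x \<otimes> (inv x \<otimes> y) = y" "inv x \<otimes> (x \<otimes> y) = y"
  using assms by (simp_all flip: m_assoc)

lemma (in group) normal_in_subgroup_iff:
  assumes K: "subgroup K G"
  shows "H \<lhd> G\<lparr>carrier := K\<rparr> \<longleftrightarrow>
    subgroup H G \<and> H \<subseteq> K \<and> (\<forall>x\<in>K. \<forall>h\<in>H. x \<otimes> h \<otimes> inv x \<in> H)"
proof -
  interpret K: group "G\<lparr>carrier := K\<rparr>"
    using K by (rule subgroup_imp_group)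
  have "subgroup H (G\<lparr>carrier := K\<rparr>) \<longleftrightarrow> subgroup H G \<and> H \<subseteq> K"
    using incl_subgroup[OF K] subgroup_incl[OF _ K] subgroup.subset[of H "G\<lparr>carrier := K\<rparr>"]
    by auto
  moreover have "inv\<^bsub>G\<lparr>carrier := K\<rparr>\<^esub> x = inv x" if "x \<in> K" for x
    using K that by simp
  ultimately show ?thesis
    unfolding K.normal_inv_iff by auto
qed

lemma (in group) finite_subgroup:
  "finite (carrier G) \<Longrightarrow> subgroup H G \<Longrightarrow> finite H"
  by (meson finite_subset subgroup.subset)

lemma (in group) card_subgroup_dvd:
  assumes "finite (carrier G)" "subgroup H G" "subgroup K G" "H \<subseteq> K"
  shows "card H dvd card K"
proof -
  interpret K: group "G\<lparr>carrier := K\<rparr>"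
    using assms subgroup_imp_group by blast
  have "card (rcosets\<^bsub>G\<lparr>carrier := K\<rparr>\<^esub> H) * card H = card K"
    using K.lagrange[of H] assms subgroup_incl[of H K] by (simp add: order_def)
  then show ?thesis by (metis dvd_triv_right)
qed

subsection \<open>Elements of prime power order\<close>

text \<open>Phrased by an exponent rather than by \<open>ord\<close>: power laws alone then carry it
  over to conjugates and to groups with a restricted carrier.\<close>

definition p_element :: "('a, 'b) monoid_scheme \<Rightarrow> nat \<Rightarrow> 'a \<Rightarrow> bool" where
  "p_element G p x \<longleftrightarrow> x \<in> carrier G \<and> (\<exists>k. x [^]\<^bsub>G\<^esub> (p ^ k) = \<one>\<^bsub>G\<^esub>)"

lemma (in group) p_element_in_subgroup_iff:
  "subgroup K G \<Longrightarrow> p_element (G\<lparr>carrier := K\<rparr>) p x \<longleftrightarrow> p_element G p x \<and> x \<in> K"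
  by (auto simp: p_element_def nat_pow_consistent[symmetric] subgroup.mem_carrier)

lemma (in group) nat_pow_conj:
  assumes "g \<in> carrier G" "x \<in> carrier G"
  shows "(g \<otimes> x \<otimes> inv g) [^] (n::nat) = g \<otimes> x [^] n \<otimes> inv g"
  using assms by (induction n) (simp_all add: m_assoc)

lemma (in group) p_element_conj:
  assumes "p_element G p x" "g \<in> carrier G"
  shows "p_element G p (g \<otimes> x \<otimes> inv g)"
  using assms r_inv unfolding p_element_def by (metis nat_pow_conj m_closed inv_closed r_one)

lemma (in group) p_element_in_p_subgroup:
  assumes "subgroup H G" "card H = p ^ k" "x \<in> H"
  shows "p_element G p x"
proof -
  interpret H: group "G\<lparr>carrier := H\<rparr>"
    using assms subgroup_imp_group by blast
  have "x [^] (p ^ k) = \<one>"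
    using H.pow_order_eq_1[of x] assms by (simp add: order_def nat_pow_consistent[symmetric])
  then show ?thesis
    using assms subgroup.mem_carrier by (force simp: p_element_def)
qed

lemma (in group) card_generate_p_element:
  assumes "finite (carrier G)" "Factorial_Ring.prime p" "p_element G p x"
  obtains k where "card (generate G {x}) = p ^ k"
proof -
  obtain k where x: "x \<in> carrier G" and "x [^] (p ^ k) = \<one>"
    using assms by (auto simp: p_element_def)
  then have "ord x dvd p ^ k"
    using pow_eq_id by auto
  then obtain i where "ord x = p ^ i"
    using assms(2) divides_primepow_nat by blast
  then show thesis
    using that generate_pow_card[OF x] by metis
qed

lemma (in group) p_element_q_element_trivial:
  assumes "Factorial_Ring.prime p" "Factorial_Ring.prime q" "p \<noteq> q"
    and "p_element G p x" "p_element G q x"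
  shows "x = \<one>"
proof -
  obtain i j where x: "x \<in> carrier G" and "x [^] (p ^ i) = \<one>" "x [^] (q ^ j) = \<one>"
    using assms by (auto simp: p_element_def)
  then have "ord x dvd p ^ i" "ord x dvd q ^ j"
    using pow_eq_id by auto
  moreover have "coprime (p ^ i) (q ^ j)"
    using assms primes_coprime by auto
  ultimately have "ord x = 1"
    using coprime_common_divisor_nat by blast
  then show ?thesis using x ord_eq_1 by blast
qed

subsection \<open>Sylow subgroups\<close>

text \<open>The points moved by a p-group split into orbits whose sizes are nontrivial powers of p.\<close>
lemma p_group_moved_points:
  assumes Q: "group Q" "order Q = p ^ n" "Factorial_Ring.prime p" and "finite E"
    and closed: "\<And>g x. g \<in> carrier Q \<Longrightarrow> x \<in> E \<Longrightarrow> act g x \<in> E"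
    and one: "\<And>x. x \<in> E \<Longrightarrow> act \<one>\<^bsub>Q\<^esub> x = x"
    and mult: "\<And>g h x. g \<in> carrier Q \<Longrightarrow> h \<in> carrier Q \<Longrightarrow> x \<in> E \<Longrightarrow>
      act (g \<otimes>\<^bsub>Q\<^esub> h) x = act g (act h x)"
  shows "p dvd card {x \<in> E. \<exists>g\<in>carrier Q. act g x \<noteq> x}"
proof -
  interpret Q: group Q by fact
  define M where "M = {x \<in> E. \<exists>g\<in>carrier Q. act g x \<noteq> x}"
  \<comment> \<open>\<open>Bij M\<close> demands extensional functions, hence
    \<open>restrict\<close>. Acting on \<open>M\<close> instead of \<open>E\<close> leaves no orbit
    of size 1.\<close>
  define \<phi> where "\<phi> g = restrict (act g) M" for g
  have inv: "act (inv\<^bsub>Q\<^esub> g) (act g x) = x" "act g (act (inv\<^bsub>Q\<^esub> g) x) = x"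
    if "g \<in> carrier Q" "x \<in> E" for g x
    using that mult one Q.l_inv Q.r_inv Q.inv_closed by metis+
  have M: "act g x \<in> M" if g: "g \<in> carrier Q" and x: "x \<in> M" for g x
  proof -
    obtain h where "x \<in> E" and h: "h \<in> carrier Q" "act h x \<noteq> x"
      using x by (auto simp: M_def)
    let ?k = "g \<otimes>\<^bsub>Q\<^esub> h \<otimes>\<^bsub>Q\<^esub> inv\<^bsub>Q\<^esub> g"
    have "act ?k (act g x) = act g (act h x)"
      using g h \<open>x \<in> E\<close> by (simp add: mult closed inv)
    moreover have "act g (act h x) \<noteq> act g x"
      using inv(1)[OF g] h \<open>x \<in> E\<close> closed by metis
    ultimately show ?thesis
      using g h \<open>x \<in> E\<close> closed by (auto simp: M_def intro!: bexI[of _ ?k])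
  qed
  have "M \<subseteq> E" "finite M"
    using \<open>finite E\<close> by (auto simp: M_def)
  have bij: "\<phi> g \<in> Bij M" if "g \<in> carrier Q" for g
    unfolding Bij_def \<phi>_def using that M inv \<open>M \<subseteq> E\<close>
    by (auto intro!: bij_betw_byWitness[where f' = "act (inv\<^bsub>Q\<^esub> g)"])
  interpret group_action Q M \<phi>
  proof (intro group_action.intro group_hom.intro group_hom_axioms.intro)
    show "\<phi> \<in> hom Q (BijGroup M)"
    proof (rule homI)
      fix g h assume "g \<in> carrier Q" "h \<in> carrier Q"
      then show "\<phi> (g \<otimes>\<^bsub>Q\<^esub> h) = \<phi> g \<otimes>\<^bsub>BijGroup M\<^esub> \<phi> h"
        using bij M \<open>M \<subseteq> E\<close> by (auto simp: BijGroup_def \<phi>_def compose_def mult fun_eq_iff)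
    qed (use bij in \<open>simp add: BijGroup_def\<close>)
  qed (use Q group_BijGroup in auto)
  have "p dvd card orb" if orb: "orb \<in> orbits Q M \<phi>" for orb
  proof -
    obtain x where x: "x \<in> M" "orb = orbit Q \<phi> x"
      using orb by (auto simp: orbits_def)
    then obtain g where g: "g \<in> carrier Q" "act g x \<noteq> x"
      by (auto simp: M_def)
    then have "{x, act g x} \<subseteq> orb"
      using x orbit_refl[of x] by (auto simp: orbit_def \<phi>_def)
    moreover have "orb \<subseteq> M"
      using x M by (auto simp: orbit_def \<phi>_def)
    ultimately have "card {x, act g x} \<le> card orb"
      using \<open>finite M\<close> by (meson card_mono finite_subset)
    then have "card orb \<noteq> 1"
      using g by simp
    moreover have "card orb dvd p ^ n"
      using orbit_stabilizer_theorem[OF x(1)] x(2) Q(2) by (metis dvd_triv_left)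
    ultimately show ?thesis
      using Q(3) by (metis divides_primepow_nat dvd_power gr0I power_0)
  qed
  moreover have "pairwise disjnt (orbits Q M \<phi>)"
    using disjoint_union by (auto simp: pairwise_def disjnt_def)
  ultimately have "p dvd card (\<Union> (orbits Q M \<phi>))"
    using \<open>finite M\<close> orbits_coverture
    by (intro dvd_partition) (auto simp: disjnt_def pairwise_def)
  then show ?thesis
    unfolding M_def[symmetric] orbits_coverture .
qed

text \<open>Let \<open>H\<close> act by right multiplication on the right cosets of
  \<open>P\<close>. Their number is prime to p, while the number of moved ones is divisible by p, so
  some coset \<open>P #> a\<close> is fixed; this says that conjugation by \<open>a\<close> takes
  \<open>H\<close> into \<open>P\<close>.\<close>

lemma (in group) sylow_subgroup_conj_contains:
  assumes fin: "finite (carrier G)" and P: "sylow_subgroup G p P"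
    and H: "subgroup H G" "card H = p ^ k"
  obtains a where "a \<in> carrier G" "\<And>h. h \<in> H \<Longrightarrow> a \<otimes> h \<otimes> inv a \<in> P"
proof -
  have p: "Factorial_Ring.prime p" and "subgroup P G"
    and cardP: "card P = p ^ multiplicity p (order G)"
    using P by (auto simp: sylow_subgroup_def)
  interpret P: subgroup P G by fact
  interpret H: subgroup H G by fact
  interpret HG: group "G\<lparr>carrier := H\<rparr>"
    using H(1) subgroup_imp_group by blast
  have "order G > 0"
    using fin order_gt_0_iff_finite by blast
  have index: "card (rcosets P) * card P = order G"
    using lagrange \<open>subgroup P G\<close> by blast
  define C where "C = rcosets P"
  have "\<not> p dvd card C"
  proof
    assume "p dvd card C"
    then have "p ^ Suc (multiplicity p (order G)) dvd order G"
      using index cardP unfolding C_def by (metis dvd_refl mult_dvd_mono power_Suc)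
    then show False
      using p \<open>order G > 0\<close>
      by (metis gr_implies_not0 linorder_not_le lessI not_prime_unit power_dvd_iff_le_multiplicity)
  qed
  \<comment> \<open>The inverse turns right multiplication into a left action.\<close>
  moreover have "p dvd card {Y \<in> C. \<exists>h\<in>carrier (G\<lparr>carrier := H\<rparr>). Y #> inv h \<noteq> Y}"
  proof (rule p_group_moved_points)
    show "order (G\<lparr>carrier := H\<rparr>) = p ^ k"
      using H by (simp add: order_def)
    show "finite C"
      unfolding C_def using fin rcosets_subset_PowG[OF \<open>subgroup P G\<close>] by (meson finite_Pow_iff finite_subset)
    fix g Y assume g: "g \<in> carrier (G\<lparr>carrier := H\<rparr>)" and "Y \<in> C"
    then obtain a where a: "a \<in> carrier G" "Y = P #> a"
      by (auto simp: C_def RCOSETS_def)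
    show "Y #> inv g \<in> C"
      using a g by (simp add: C_def coset_mult_assoc P.subset rcosetsI)
    fix h assume h: "h \<in> carrier (G\<lparr>carrier := H\<rparr>)"
    show "Y #> inv (g \<otimes>\<^bsub>G\<lparr>carrier := H\<rparr>\<^esub> h) = Y #> inv h #> inv g"
      using a g h by (simp add: coset_mult_assoc P.subset inv_mult_group m_assoc)
  qed (use p in \<open>auto simp: C_def RCOSETS_def coset_mult_assoc P.subset HG.is_group\<close>)
  ultimately have "{Y \<in> C. \<exists>h\<in>H. Y #> inv h \<noteq> Y} \<noteq> C"
    by force
  then obtain a where a: "a \<in> carrier G" "\<And>h. h \<in> H \<Longrightarrow> P #> a #> inv h = P #> a"
    unfolding C_def RCOSETS_def by blast
  have "a \<otimes> h \<otimes> inv a \<in> P" if h: "h \<in> H" for h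
  proof -
    have "P #> (a \<otimes> h) = P #> a"
      using a(2)[of "inv h"] a(1) h by (simp add: coset_mult_assoc P.subset)
    then have "a \<otimes> h \<in> P #> a"
      using rcos_self[of "a \<otimes> h" P] a(1) h \<open>subgroup P G\<close> by auto
    then show ?thesis
      using a(1) h P.rcos_module by (simp add: is_group)
  qed
  with a(1) show thesis using that by blast
qed

section \<open>Conjugate subgroups, normalizers and Sylow subgroups\<close>

lemma (in group) conj_m_inv_cancel:
  assumes "g \<in> carrier G" "x \<in> carrier G"
  shows "inv g \<otimes> (g \<otimes> x \<otimes> inv g) \<otimes> g = x" "g \<otimes> (inv g \<otimes> x \<otimes> g) \<otimes> inv g = x"
  using assms by (simp_all add: m_assoc)

lemma (in group) subgroup_conj:
  assumes "subgroup H G" "g \<in> carrier G"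
  shows "subgroup ((\<lambda>x. g \<otimes> x \<otimes> inv g) ` H) G"
proof (rule subgroupI)
  interpret H: subgroup H G by fact
  fix a assume "a \<in> (\<lambda>x. g \<otimes> x \<otimes> inv g) ` H"
  then obtain x where x: "x \<in> H" "a = g \<otimes> x \<otimes> inv g" by blast
  then show "inv a \<in> (\<lambda>x. g \<otimes> x \<otimes> inv g) ` H"
    using assms by (intro image_eqI[of _ _ "inv x"]) (simp_all add: inv_mult_group m_assoc)
  fix b assume "b \<in> (\<lambda>x. g \<otimes> x \<otimes> inv g) ` H"
  then obtain y where "y \<in> H" "b = g \<otimes> y \<otimes> inv g" by blast
  with x show "a \<otimes> b \<in> (\<lambda>x. g \<otimes> x \<otimes> inv g) ` H"
    using assms by (intro image_eqI[of _ _ "x \<otimes> y"]) (simp_all add: m_assoc)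
qed (use assms subgroup.subset[of H G] subgroup.one_closed[of H G] in auto)

lemma (in group) inj_on_conj: "g \<in> carrier G \<Longrightarrow> H \<subseteq> carrier G \<Longrightarrow> inj_on (\<lambda>x. g \<otimes> x \<otimes> inv g) H"
  by (rule inj_onI) (metis conj_m_inv_cancel(1) subsetD)

lemma (in group) conj_image_eq:
  assumes "finite H" "H \<subseteq> carrier G" "g \<in> carrier G" "\<And>h. h \<in> H \<Longrightarrow> g \<otimes> h \<otimes> inv g \<in> H"
  shows "(\<lambda>h. g \<otimes> h \<otimes> inv g) ` H = H"
  using assms by (intro endo_inj_surj inj_on_conj) auto

text \<open>\<open>normalizer\<close> is a stabilizer and so asks for equality of \<open>H\<close>
  with its conjugate. Conjugation is injective, so on a finite \<open>H\<close> mapping into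
  \<open>H\<close> is enough.\<close>

lemma (in group) normalizer_iff:
  assumes "finite H" "H \<subseteq> carrier G"
  shows "g \<in> normalizer G H \<longleftrightarrow> g \<in> carrier G \<and> (\<forall>h\<in>H. g \<otimes> h \<otimes> inv g \<in> H)"
proof -
  have "g <# H #> inv g = (\<lambda>h. g \<otimes> h \<otimes> inv g) ` H"
    by (auto simp: l_coset_def r_coset_def)
  moreover have "(\<lambda>h. g \<otimes> h \<otimes> inv g) ` H = H \<longleftrightarrow> (\<forall>h\<in>H. g \<otimes> h \<otimes> inv g \<in> H)" if "g \<in> carrier G"
    using conj_image_eq[OF assms that] by blast
  ultimately show ?thesis
    using assms by (auto simp: normalizer_def stabilizer_def)
qed

lemma (in group) normal_in_normalizer:
  assumes "finite (carrier G)" "subgroup H G"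
  shows "subgroup (normalizer G H) G" "H \<subseteq> normalizer G H" "H \<lhd> G\<lparr>carrier := normalizer G H\<rparr>"
proof -
  interpret H: subgroup H G by fact
  have iff: "g \<in> normalizer G H \<longleftrightarrow> g \<in> carrier G \<and> (\<forall>h\<in>H. g \<otimes> h \<otimes> inv g \<in> H)" for g
    using normalizer_iff assms finite_subgroup H.subset by blast
  show *: "subgroup (normalizer G H) G"
    using normalizer_imp_subgroup H.subset by blast
  show "H \<subseteq> normalizer G H"
    by (auto simp: iff)
  then show "H \<lhd> G\<lparr>carrier := normalizer G H\<rparr>"
    using assms by (auto simp: normal_in_subgroup_iff[OF *] iff)
qed

lemma (in group) sylow_subgroup_exists:
  assumes "finite (carrier G)" "Factorial_Ring.prime p"
  shows "\<exists>P. sylow_subgroup G p P"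
proof -
  have "order G = p ^ multiplicity p (order G) * (order G div p ^ multiplicity p (order G))"
    by (simp add: multiplicity_dvd)
  then show ?thesis
    using sylow_thm[OF assms(2) is_group _ assms(1)] assms(2)
    unfolding sylow_subgroup_def by blast
qed

text \<open>\<open>card P\<close> divides \<open>card J\<close>, which divides
  \<open>order G\<close>; so \<open>J\<close> and \<open>G\<close> have the same p-part.\<close>

lemma (in group) sylow_subgroup_in_subgroup:
  assumes "finite (carrier G)" "sylow_subgroup G p P" "subgroup J G" "P \<subseteq> J"
  shows "sylow_subgroup (G\<lparr>carrier := J\<rparr>) p P"
proof -
  have P: "Factorial_Ring.prime p" "subgroup P G" "card P = p ^ multiplicity p (order G)"
    using assms by (auto simp: sylow_subgroup_def)
  have "order G > 0" "card J > 0"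
    using assms order_gt_0_iff_finite subgroup.finite_imp_card_positive by auto
  moreover have "card P dvd card J" "card J dvd order G"
    using P assms card_subgroup_dvd[of P J] card_subgroup_dvd[of J "carrier G"]
      subgroup_self subgroup.subset[of J G] by (auto simp: order_def)
  ultimately have "multiplicity p (card J) = multiplicity p (order G)"
    using P by (intro antisym dvd_imp_multiplicity_le multiplicity_geI) auto
  then show ?thesis
    using P assms subgroup_incl by (auto simp: sylow_subgroup_def order_def)
qed

lemma (in group) sylow_subgroup_conj:
  assumes "sylow_subgroup G p P" "g \<in> carrier G"
  shows "sylow_subgroup G p ((\<lambda>x. g \<otimes> x \<otimes> inv g) ` P)"
  using assms subgroup_conj subgroup.subset[of P G]
  by (auto simp: sylow_subgroup_def card_image inj_on_conj)

lemma (in group) sylow_subgroup_p_element: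
  "sylow_subgroup G p P \<Longrightarrow> x \<in> P \<Longrightarrow> p_element G p x"
  using p_element_in_p_subgroup by (auto simp: sylow_subgroup_def)

lemma (in group) p_element_conj_in_sylow_subgroup:
  assumes "finite (carrier G)" "sylow_subgroup G p P" "p_element G p x"
  obtains a where "a \<in> carrier G" "a \<otimes> x \<otimes> inv a \<in> P"
proof -
  have x: "x \<in> carrier G"
    using assms by (simp add: p_element_def)
  obtain k where "card (generate G {x}) = p ^ k"
    using assms card_generate_p_element by (metis sylow_subgroup_def)
  moreover have "subgroup (generate G {x}) G"
    using x generate_is_subgroup by simp
  ultimately obtain a where "a \<in> carrier G" "\<And>h. h \<in> generate G {x} \<Longrightarrow> a \<otimes> h \<otimes> inv a \<in> P"
    using sylow_subgroup_conj_contains[OF assms(1,2)] by metis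
  then show thesis
    using that generate.incl[of x "{x}" G] by blast
qed

lemma (in group) p_element_in_sylow_subgroup:
  assumes "finite (carrier G)" "Factorial_Ring.prime p" "p_element G p x"
  obtains P where "sylow_subgroup G p P" "x \<in> P"
proof -
  obtain P where P: "sylow_subgroup G p P"
    using assms sylow_subgroup_exists by blast
  obtain a where a: "a \<in> carrier G" "a \<otimes> x \<otimes> inv a \<in> P"
    using p_element_conj_in_sylow_subgroup[OF assms(1) P assms(3)] by blast
  have "x = inv a \<otimes> (a \<otimes> x \<otimes> inv a) \<otimes> inv (inv a)"
    using a assms by (simp add: conj_m_inv_cancel p_element_def)
  then show thesis
    using that[OF sylow_subgroup_conj[OF P, of "inv a"]] a by blast
qed

text \<open>Inside its normalizer \<open>P\<close> is a Sylow subgroup, so some conjugate of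
  \<open>x\<close> there lies in \<open>P\<close>; since \<open>P\<close> is also normal there,
  conjugating back stays in \<open>P\<close>.\<close>

lemma (in group) p_element_normalizing_sylow_subgroup:
  assumes fin: "finite (carrier G)" and P: "sylow_subgroup G p P" and x: "p_element G p x"
    and "x \<in> normalizer G P"
  shows "x \<in> P"
proof -
  let ?N = "normalizer G P"
  have "subgroup P G" using P by (simp add: sylow_subgroup_def)
  note N = normal_in_normalizer[OF fin this]
  interpret N: group "G\<lparr>carrier := ?N\<rparr>"
    using N(1) subgroup_imp_group by blast
  have "finite ?N" using fin N(1) finite_subgroup by blast
  then obtain a where a: "a \<in> ?N" "a \<otimes> x \<otimes> inv a \<in> P"
    using N.p_element_conj_in_sylow_subgroup[of p P x] sylow_subgroup_in_subgroup[OF fin P N(1,2)] N(1) x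
      assms(4) by (auto simp: p_element_in_subgroup_iff)
  then have "inv a \<otimes> (a \<otimes> x \<otimes> inv a) \<otimes> inv (inv a) \<in> P"
    using N by (auto simp: normal_in_subgroup_iff subgroup.m_inv_closed simp del: inv_inv)
  moreover have "a \<in> carrier G"
    using a N(1) subgroup.mem_carrier by fast
  ultimately show ?thesis
    using x by (simp add: conj_m_inv_cancel p_element_def)
qed

text \<open>Conjugation by \<open>g\<close> sends each element of \<open>P\<close> to a p-element
  that normalizes \<open>P\<close>, and such an element lies in \<open>P\<close>.\<close>

lemma (in group) normalizer_sylow_subgroup_self_normalizing:
  assumes fin: "finite (carrier G)" and P: "sylow_subgroup G p P" and g: "g \<in> carrier G"
    and "\<And>h. h \<in> normalizer G P \<Longrightarrow> g \<otimes> h \<otimes> inv g \<in> normalizer G P"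
  shows "g \<in> normalizer G P"
proof -
  have "subgroup P G" using P by (simp add: sylow_subgroup_def)
  then have "finite P" "P \<subseteq> carrier G" "P \<subseteq> normalizer G P"
    using fin finite_subgroup subgroup.subset normal_in_normalizer(2) by auto
  moreover have "g \<otimes> x \<otimes> inv g \<in> P" if "x \<in> P" for x
    using that assms P \<open>P \<subseteq> normalizer G P\<close>
    by (intro p_element_normalizing_sylow_subgroup[OF fin P] p_element_conj)
      (auto intro: sylow_subgroup_p_element)
  ultimately show ?thesis
    using g by (simp add: normalizer_iff)
qed

lemma (in group) subgroup_eq_carrierI:
  assumes fin: "finite (carrier G)" and H: "subgroup H G"
    and "\<And>p. Factorial_Ring.prime p \<Longrightarrow> \<exists>P. sylow_subgroup G p P \<and> P \<subseteq> H"
  shows "H = carrier G"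
proof -
  have pos: "order G > 0" "card H > 0"
    using assms order_gt_0_iff_finite subgroup.finite_imp_card_positive by auto
  have "multiplicity p (order G) \<le> multiplicity p (card H)" if p: "Factorial_Ring.prime p" for p :: nat
  proof -
    obtain P where "sylow_subgroup G p P" "P \<subseteq> H" using assms(3)[OF p] by blast
    then have "p ^ multiplicity p (order G) dvd card H"
      using card_subgroup_dvd[OF fin _ H] unfolding sylow_subgroup_def by metis
    then show ?thesis
      using p pos by (intro multiplicity_geI) auto
  qed
  then have "order G dvd card H"
    using pos by (intro multiplicity_le_imp_dvd) auto
  then have "order G \<le> card H"
    using pos dvd_imp_le by blast
  then show ?thesis
    using card_seteq[OF fin subgroup.subset[OF H]] by (simp add: order_def)
qed

text \<open>A finite group is generated by its Sylow subgroups; this is applied to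
  \<open>H \<inter> K\<close> inside \<open>K\<close>. It reduces an inclusion of subgroups to
  elements of prime power order.\<close>

lemma (in group) subgroup_containing_p_elements:
  assumes fin: "finite (carrier G)" and H: "subgroup H G" and K: "subgroup K G"
    and prim: "\<And>p x. Factorial_Ring.prime p \<Longrightarrow> p_element G p x \<Longrightarrow> x \<in> K \<Longrightarrow> x \<in> H"
  shows "K \<subseteq> H"
proof -
  interpret K: group "G\<lparr>carrier := K\<rparr>"
    using K subgroup_imp_group by blast
  have "finite K" using fin K finite_subgroup by blast
  have "H \<inter> K = carrier (G\<lparr>carrier := K\<rparr>)"
  proof (rule K.subgroup_eq_carrierI)
    show "subgroup (H \<inter> K) (G\<lparr>carrier := K\<rparr>)"
      using H K subgroups_Inter_pair subgroup_incl by simp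
    fix p :: nat assume p: "Factorial_Ring.prime p"
    then obtain P where P: "sylow_subgroup (G\<lparr>carrier := K\<rparr>) p P"
      using K.sylow_subgroup_exists \<open>finite K\<close> by auto
    then have "P \<subseteq> H \<inter> K"
      using K.sylow_subgroup_p_element[OF P] prim[OF p] p_element_in_subgroup_iff[OF K] by blast
    with P show "\<exists>P. sylow_subgroup (G\<lparr>carrier := K\<rparr>) p P \<and> P \<subseteq> H \<inter> K" by blast
  qed (use \<open>finite K\<close> in simp)
  then show ?thesis by auto
qed

subsection \<open>Subnormal subgroups\<close>

lemma (in group) subnormal_in_subgroups:
  assumes "subnormal_in G H K"
  shows "subgroup H G \<and> subgroup K G \<and> H \<subseteq> K"
  using assms
proof induction
  case (step H L K)
  then show ?case using normal_in_subgroup_iff by blast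
qed auto

lemma (in group) subnormal_in_trans_normal:
  assumes "subnormal_in G L K" "subgroup H G" "H \<subseteq> L" "\<And>x h. x \<in> L \<Longrightarrow> h \<in> H \<Longrightarrow> x \<otimes> h \<otimes> inv x \<in> H"
  shows "subnormal_in G H K"
  using assms subnormal_in_subgroups[OF assms(1)]
  by (intro subnormal_in.step[OF _ assms(1)]) (simp add: normal_in_subgroup_iff)

text \<open>Taking the conjugating element in N, not just in K, is what gives
  \<open>H \<subseteq> S\<close> for \<open>N = H\<close>; it is found by going down the subnormal series.\<close>
lemma (in group) subnormal_in_conj_in_sylow_subgroup:
  assumes fin: "finite (carrier G)"
    and "subnormal_in G N K" "sylow_subgroup (G\<lparr>carrier := K\<rparr>) p S"
    and "subgroup H G" "card H = p ^ k" "H \<subseteq> N"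
  shows "\<exists>n\<in>N. \<forall>h\<in>H. n \<otimes> h \<otimes> inv n \<in> S"
  using assms(2-)
proof (induction arbitrary: H k)
  case (refl K)
  interpret K: group "G\<lparr>carrier := K\<rparr>"
    using refl subgroup_imp_group by blast
  have "finite K" using fin refl finite_subgroup by blast
  then obtain a where "a \<in> K" "\<And>h. h \<in> H \<Longrightarrow> a \<otimes> h \<otimes> inv\<^bsub>G\<lparr>carrier := K\<rparr>\<^esub> a \<in> S"
    using K.sylow_subgroup_conj_contains[of p S H k] refl subgroup_incl by auto
  then show ?case using refl(1) by auto
next
  case (step N L K)
  have L: "subgroup L G" using step.hyps subnormal_in_subgroups by blast
  then have N: "subgroup N G" "N \<subseteq> L" "\<And>x h. x \<in> L \<Longrightarrow> h \<in> N \<Longrightarrow> x \<otimes> h \<otimes> inv x \<in> N"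
    using step.hyps normal_in_subgroup_iff by auto
  interpret N: group "G\<lparr>carrier := N\<rparr>"
    using N subgroup_imp_group by blast
  have finN: "finite N" using fin N finite_subgroup by blast
  have p: "Factorial_Ring.prime p" using step.prems by (simp add: sylow_subgroup_def)
  then obtain T where T: "sylow_subgroup (G\<lparr>carrier := N\<rparr>) p T"
    using N.sylow_subgroup_exists finN by auto
  then have TG: "subgroup T G" "T \<subseteq> N" and "\<exists>k. card T = p ^ k"
    using incl_subgroup[OF N(1)] subgroup.subset[of T "G\<lparr>carrier := N\<rparr>"]
    by (auto simp: sylow_subgroup_def)
  then obtain l where l: "l \<in> L" "\<And>t. t \<in> T \<Longrightarrow> l \<otimes> t \<otimes> inv l \<in> S"
    using step.IH[OF step.prems(1) TG(1)] N(2) by blast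
  have lG: "l \<in> carrier G" using l L subgroup.mem_carrier by fast
  \<comment> \<open>\<open>N\<close> is normal in \<open>L\<close>, so conjugating by
    \<open>l\<close> turns \<open>T\<close> into another Sylow subgroup of \<open>N\<close>, now
    inside \<open>S\<close>. Conjugacy within \<open>N\<close> moves \<open>H\<close> into it, which
    is how the conjugating element gets down from \<open>L\<close> to \<open>N\<close>.\<close>
  let ?T = "(\<lambda>x. l \<otimes> x \<otimes> inv l) ` T"
  have "subgroup ?T G" "card ?T = card T" "?T \<subseteq> N"
    using TG lG l N subgroup_conj subgroup.subset[OF TG(1)]
    by (auto simp: card_image inj_on_conj)
  then have "sylow_subgroup (G\<lparr>carrier := N\<rparr>) p ?T"
    using T N subgroup_incl by (simp add: sylow_subgroup_def)
  then obtain n where "n \<in> N" "\<And>h. h \<in> H \<Longrightarrow> n \<otimes> h \<otimes> inv\<^bsub>G\<lparr>carrier := N\<rparr>\<^esub> n \<in> ?T"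
    using N.sylow_subgroup_conj_contains[of p ?T H k] step.prems finN subgroup_incl N(1) by auto
  moreover have "?T \<subseteq> S"
    using l by blast
  ultimately have "n \<in> N" "\<forall>h\<in>H. n \<otimes> h \<otimes> inv n \<in> S"
    using N(1) by fastforce+
  then show ?case by blast
qed

lemma (in group) subnormal_in_sylow_subgroup:
  assumes fin: "finite (carrier G)"
    and "subnormal_in G H K" "sylow_subgroup (G\<lparr>carrier := K\<rparr>) p S" "card H = p ^ k"
  shows "H \<subseteq> S"
proof -
  interpret H: subgroup H G
    using assms subnormal_in_subgroups by blast
  obtain n where n: "n \<in> H" "\<forall>h\<in>H. n \<otimes> h \<otimes> inv n \<in> S"
    using subnormal_in_conj_in_sylow_subgroup[OF assms(1-3) _ assms(4)] H.is_subgroup by blast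
  show ?thesis
  proof
    fix h assume h: "h \<in> H"
    then have "n \<otimes> (inv n \<otimes> h \<otimes> n) \<otimes> inv n \<in> S"
      using n by auto
    then show "h \<in> S"
      using n h by (simp add: conj_m_inv_cancel)
  qed
qed

text \<open>The group just above \<open>H\<close> in the series normalizes \<open>H\<close>, hence
  equals it; the series collapses from the bottom.\<close>

lemma (in group) subnormal_in_self_normalizing:
  assumes "subnormal_in G H K"
    and "\<And>g. g \<in> K \<Longrightarrow> \<forall>h\<in>H. g \<otimes> h \<otimes> inv g \<in> H \<Longrightarrow> g \<in> H"
  shows "H = K"
  using assms
proof induction
  case (step H L K)
  have L: "subgroup L G" "L \<subseteq> K" using step.hyps subnormal_in_subgroups by auto
  then have "H \<subseteq> L" "\<And>x h. x \<in> L \<Longrightarrow> h \<in> H \<Longrightarrow> x \<otimes> h \<otimes> inv x \<in> H"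
    using step.hyps normal_in_subgroup_iff by auto
  then have "H = L" using L step.prems by blast
  then show ?case using step by blast
qed auto

subsection \<open>Nilpotent groups\<close>

text \<open>\<open>A\<close> may be any set of elements: later it is a singleton, which gives the
  centralizer of one element modulo \<open>B\<close>.\<close>

lemma (in group) subgroup_section_centralizer:
  assumes "A \<subseteq> carrier G" "B \<lhd> G"
  shows "subgroup (section_centralizer G A B) G"
proof (rule subgroupI)
  interpret B: normal B G by fact
  have A: "a \<in> carrier G" if "a \<in> A" for a
    using that assms by blast
  show "section_centralizer G A B \<noteq> {}"
    using A by (auto simp: section_centralizer_def intro!: exI[of _ \<one>])
  fix g assume g: "g \<in> section_centralizer G A B"
  then have gG: "g \<in> carrier G"
    by (simp add: section_centralizer_def)
  show "inv g \<in> section_centralizer G A B"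
    unfolding section_centralizer_def
  proof (intro CollectI conjI ballI)
    fix a assume a: "a \<in> A"
    then have "inv (a \<otimes> g \<otimes> inv a \<otimes> inv g) \<in> B"
      using g by (simp add: section_centralizer_def)
    then have "inv g \<otimes> inv (a \<otimes> g \<otimes> inv a \<otimes> inv g) \<otimes> g \<in> B"
      using gG B.inv_op_closed1 by blast
    moreover have "inv g \<otimes> inv (a \<otimes> g \<otimes> inv a \<otimes> inv g) \<otimes> g = a \<otimes> inv g \<otimes> inv a \<otimes> inv (inv g)"
      using gG A[OF a] by (simp add: inv_mult_group m_assoc)
    ultimately show "a \<otimes> inv g \<otimes> inv a \<otimes> inv (inv g) \<in> B" by simp
  qed (use gG in simp)
  fix h assume h: "h \<in> section_centralizer G A B"
  then have hG: "h \<in> carrier G"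
    by (simp add: section_centralizer_def)
  show "g \<otimes> h \<in> section_centralizer G A B"
    unfolding section_centralizer_def
  proof (intro CollectI conjI ballI)
    fix a assume a: "a \<in> A"
    \<comment> \<open>With \<open>[a, g]\<close> for the commutator, this is the identity
      \<open>[a, gh] = [a, g] (g [a, h] inv g)\<close>.\<close>
    have "(a \<otimes> g \<otimes> inv a \<otimes> inv g) \<otimes> (g \<otimes> (a \<otimes> h \<otimes> inv a \<otimes> inv h) \<otimes> inv g) \<in> B"
      using g h a gG B.inv_op_closed2 by (simp add: section_centralizer_def)
    moreover have "(a \<otimes> g \<otimes> inv a \<otimes> inv g) \<otimes> (g \<otimes> (a \<otimes> h \<otimes> inv a \<otimes> inv h) \<otimes> inv g)
        = a \<otimes> (g \<otimes> h) \<otimes> inv a \<otimes> inv (g \<otimes> h)"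
      using gG hG A[OF a] by (simp add: inv_mult_group m_assoc)
    ultimately show "a \<otimes> (g \<otimes> h) \<otimes> inv a \<otimes> inv (g \<otimes> h) \<in> B" by simp
  qed (use gG hG in simp)
qed (auto simp: section_centralizer_def)

lemma (in group) normal_section_centralizer:
  assumes "A \<lhd> G" "B \<lhd> G"
  shows "section_centralizer G A B \<lhd> G"
proof -
  interpret A: normal A G by fact
  interpret B: normal B G by fact
  show ?thesis
    unfolding normal_inv_iff
  proof (intro conjI ballI)
    fix x g assume x: "x \<in> carrier G" and g: "g \<in> section_centralizer G A B"
    then have gG: "g \<in> carrier G" by (simp add: section_centralizer_def)
    show "x \<otimes> g \<otimes> inv x \<in> section_centralizer G A B"
      unfolding section_centralizer_def
    proof (intro CollectI conjI ballI)
      fix a assume a: "a \<in> A"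
      let ?a = "inv x \<otimes> a \<otimes> x"
      have "?a \<in> A" using a x A.inv_op_closed1 by blast
      then have "x \<otimes> (?a \<otimes> g \<otimes> inv ?a \<otimes> inv g) \<otimes> inv x \<in> B"
        using g x B.inv_op_closed2 by (simp add: section_centralizer_def)
      moreover have "x \<otimes> (?a \<otimes> g \<otimes> inv ?a \<otimes> inv g) \<otimes> inv x
          = a \<otimes> (x \<otimes> g \<otimes> inv x) \<otimes> inv a \<otimes> inv (x \<otimes> g \<otimes> inv x)"
        using x gG a by (simp add: inv_mult_group m_assoc)
      ultimately show "a \<otimes> (x \<otimes> g \<otimes> inv x) \<otimes> inv a \<otimes> inv (x \<otimes> g \<otimes> inv x) \<in> B" by simp
    qed (use x gG in simp)
  qed (use assms A.subset subgroup_section_centralizer in blast)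
qed

lemma (in group) commutator_trivial_iff:
  assumes "a \<in> carrier G" "b \<in> carrier G"
  shows "a \<otimes> b \<otimes> inv a \<otimes> inv b = \<one> \<longleftrightarrow> a \<otimes> b = b \<otimes> a"
  using assms by (metis inv_closed inv_solve_right m_closed r_inv l_one)

text \<open>Conjugation by a p-group on the cosets of M fixes M, hence also another coset.\<close>
lemma (in group) p_group_central_mod_normal:
  assumes P: "order G = p ^ n" "Factorial_Ring.prime p" and M: "M \<lhd> G" "M \<noteq> carrier G"
  obtains g where "g \<in> carrier G" "g \<notin> M" "\<And>x. x \<in> carrier G \<Longrightarrow> g \<otimes> x \<otimes> inv g \<otimes> inv x \<in> M"
proof -
  interpret M: normal M G by fact
  have fin: "finite (carrier G)"
    using P prime_gt_0_nat order_gt_0_iff_finite by (metis zero_less_power)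
  define C where "C = rcosets M"
  have finC: "finite C"
    unfolding C_def using fin rcosets_subset_PowG[OF M.is_subgroup] by (meson finite_Pow_iff finite_subset)
  have C: "\<exists>a\<in>carrier G. Y = M #> a" if "Y \<in> C" for Y
    using that by (auto simp: C_def RCOSETS_def)
  have conj: "g <# (M #> a) #> inv g = M #> (g \<otimes> a \<otimes> inv g)" if "g \<in> carrier G" "a \<in> carrier G" for g a
  proof -
    have "g <# (M #> a) #> inv g = (g <# M) #> a #> inv g"
      using that M.subset by (simp add: coset_assoc)
    also have "g <# M = M #> g"
      using that M.coset_eq by simp
    finally show ?thesis
      using that M.subset by (simp add: coset_mult_assoc)
  qed
  have "M \<in> C"
    using M.subset rcosetsI[of M \<one>] by (simp add: C_def)
  have index: "card C * card M = p ^ n"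
    using lagrange[OF M.is_subgroup] P by (simp add: C_def)
  have "card C \<noteq> 1"
  proof
    assume "card C = 1"
    then have "card M = card (carrier G)" using index P by (simp add: order_def)
    then show False using M fin M.subset card_subset_eq by blast
  qed
  then have "p dvd card C"
    using index P(2) by (metis divides_primepow_nat dvd_power dvd_triv_left gr0I power_0)
  moreover have "p dvd card {Y \<in> C. \<exists>g\<in>carrier G. g <# Y #> inv g \<noteq> Y}" (is "_ dvd card ?moved")
  proof (rule p_group_moved_points[OF is_group P finC])
    fix g Y assume g: "g \<in> carrier G" and Y: "Y \<in> C"
    show "g <# Y #> inv g \<in> C"
      using g C[OF Y] M.subset by (auto simp: conj C_def rcosetsI)
    fix h assume h: "h \<in> carrier G"
    show "g \<otimes> h <# Y #> inv (g \<otimes> h) = g <# (h <# Y #> inv h) #> inv g"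
    proof -
      obtain a where "a \<in> carrier G" "Y = M #> a" using C[OF Y] by blast
      then show ?thesis
        using g h by (simp add: conj) (simp add: inv_mult_group m_assoc)
    qed
  next
    fix Y assume "Y \<in> C"
    then show "\<one> <# Y #> inv \<one> = Y"
      using C conj[of \<one>] by auto
  qed
  moreover have "card C = card ?moved + card (C - ?moved)"
    using card_Diff_subset[of ?moved C] card_mono[OF finC, of ?moved] finC by simp
  ultimately have "p dvd card (C - ?moved)"
    by (simp add: dvd_add_right_iff)
  moreover have "M \<in> C - ?moved"
    using \<open>M \<in> C\<close> conj[of _ \<one>] M.subset M.rcos_const by auto
  ultimately have "C - ?moved \<noteq> {M}"
    using P(2) by auto
  then obtain Y where Y: "Y \<in> C" "Y \<noteq> M" "\<And>g. g \<in> carrier G \<Longrightarrow> g <# Y #> inv g = Y"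
    using \<open>M \<in> C - ?moved\<close> by blast
  then obtain a where a: "a \<in> carrier G" "Y = M #> a"
    using C by blast
  show thesis
  proof (rule that[of a])
    show "a \<notin> M" using a Y M.rcos_const is_group by blast
    fix x assume x: "x \<in> carrier G"
    then have "M #> a = M #> (x \<otimes> a \<otimes> inv x)"
      using Y(3)[of x] a conj by simp
    then have "a \<in> M #> (x \<otimes> a \<otimes> inv x)"
      using rcos_self[OF a(1) M.is_subgroup] by simp
    then have "a \<otimes> inv (x \<otimes> a \<otimes> inv x) \<in> M"
      using x a M.rcos_module[OF is_group] by simp
    then show "a \<otimes> x \<otimes> inv a \<otimes> inv x \<in> M"
      using x a by (simp add: inv_mult_group m_assoc)
  qed (use a in blast)
qed

text \<open>Since \<open>N\<close> is proper, some Sylow subgroup \<open>P\<close> is not contained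
  in it, and the p-group \<open>P\<close> has an element \<open>g\<close> outside \<open>N\<close>
  that is central modulo \<open>N \<inter> P\<close>. Modulo \<open>N\<close> it commutes with
  \<open>P\<close>, and by \<open>comm\<close> it commutes with every q-element for the other primes
  q, so its centralizer modulo \<open>N\<close> contains a Sylow subgroup for each prime.\<close>

lemma (in group) central_mod_normal_exists:
  assumes fin: "finite (carrier G)"
    and comm: "\<And>p q x y. Factorial_Ring.prime p \<Longrightarrow> Factorial_Ring.prime q \<Longrightarrow> p \<noteq> q \<Longrightarrow>
      p_element G p x \<Longrightarrow> p_element G q y \<Longrightarrow> x \<otimes> y = y \<otimes> x"
    and N: "N \<lhd> G" "N \<noteq> carrier G"
  shows "\<exists>g\<in>carrier G. g \<notin> N \<and> (\<forall>x\<in>carrier G. g \<otimes> x \<otimes> inv g \<otimes> inv x \<in> N)"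
proof -
  interpret N: normal N G by fact
  have "\<not> carrier G \<subseteq> N" using N N.subset by blast
  then obtain p x where p: "Factorial_Ring.prime p" and "p_element G p x" "x \<notin> N"
    using subgroup_containing_p_elements[OF fin N.is_subgroup subgroup_self] by blast
  then obtain P where P: "sylow_subgroup G p P" "x \<in> P"
    using p_element_in_sylow_subgroup[OF fin] by metis
  then have subP: "subgroup P G" and cardP: "card P = p ^ multiplicity p (order G)"
    by (auto simp: sylow_subgroup_def)
  interpret P: group "G\<lparr>carrier := P\<rparr>"
    using subP subgroup_imp_group by blast
  have "N \<inter> P \<lhd> G\<lparr>carrier := P\<rparr>"
    using subP N.is_subgroup subgroups_Inter_pair N.inv_op_closed2 subgroup.mem_carrier[OF subP]
    by (auto simp: normal_in_subgroup_iff subgroup.m_closed subgroup.m_inv_closed)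
  then obtain g where g: "g \<in> P" "g \<notin> N \<inter> P"
    "\<And>x. x \<in> P \<Longrightarrow> g \<otimes> x \<otimes> inv\<^bsub>G\<lparr>carrier := P\<rparr>\<^esub> g \<otimes> inv\<^bsub>G\<lparr>carrier := P\<rparr>\<^esub> x \<in> N \<inter> P"
    using P.p_group_central_mod_normal[of p "multiplicity p (order G)" "N \<inter> P"] cardP p P(2) \<open>x \<notin> N\<close>
    by (auto simp: order_def)
  have gG: "g \<in> carrier G" using g subP subgroup.mem_carrier by fast
  have "section_centralizer G {g} N = carrier G"
  proof (rule subgroup_eq_carrierI[OF fin])
    show "subgroup (section_centralizer G {g} N) G"
      using gG N subgroup_section_centralizer by simp
    fix q :: nat assume q: "Factorial_Ring.prime q"
    show "\<exists>Q. sylow_subgroup G q Q \<and> Q \<subseteq> section_centralizer G {g} N"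
    proof (cases "q = p")
      case True
      have "P \<subseteq> section_centralizer G {g} N"
        using g subP subgroup.mem_carrier[OF subP] by (auto simp: section_centralizer_def)
      then show ?thesis using True P by blast
    next
      case False
      obtain Q where Q: "sylow_subgroup G q Q"
        using sylow_subgroup_exists fin q by blast
      have "y \<in> section_centralizer G {g} N" if y: "y \<in> Q" for y
      proof -
        have "p_element G q y" "p_element G p g"
          using Q P(1) y g(1) sylow_subgroup_p_element by auto
        then have "g \<otimes> y = y \<otimes> g" "y \<in> carrier G"
          using comm p q False by (auto simp: p_element_def)
        moreover from this have "g \<otimes> y \<otimes> inv g \<otimes> inv y = \<one>"
          using gG commutator_trivial_iff by blast
        ultimately show ?thesis
          by (simp add: section_centralizer_def)
      qed
      then show ?thesis using Q by blast
    qed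
  qed
  then have "\<And>x. x \<in> carrier G \<Longrightarrow> g \<otimes> x \<otimes> inv g \<otimes> inv x \<in> N"
    by (auto simp: section_centralizer_def)
  then show ?thesis using gG g by blast
qed

text \<open>Upward induction along the upper central series: the preimage \<open>?Z\<close> of the
  centre of \<open>G/N\<close> is strictly larger than \<open>N\<close>, and once a term of the
  lower central series lies in \<open>?Z\<close>, the next term lies in \<open>N\<close>.\<close>

lemma (in group) lower_central_reaches_normal:
  assumes fin: "finite (carrier G)"
    and central: "\<And>N. N \<lhd> G \<Longrightarrow> N \<noteq> carrier G \<Longrightarrow>
      \<exists>g\<in>carrier G. g \<notin> N \<and> (\<forall>x\<in>carrier G. g \<otimes> x \<otimes> inv g \<otimes> inv x \<in> N)"
    and "N \<lhd> G"
  shows "\<exists>n. lower_central G n \<subseteq> N"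
  using assms(3)
proof (induction "card (carrier G) - card N" arbitrary: N rule: less_induct)
  case less
  interpret N: normal N G by fact
  show ?case
  proof (cases "N = carrier G")
    case True
    then have "lower_central G 0 \<subseteq> N" by simp
    then show ?thesis ..
  next
    case False
    then obtain g where g: "g \<in> carrier G" "g \<notin> N" "\<And>x. x \<in> carrier G \<Longrightarrow> g \<otimes> x \<otimes> inv g \<otimes> inv x \<in> N"
      using central less by blast
    \<comment> \<open>\<open>section_centralizer\<close> writes its commutators in the order
      opposite to that of \<open>comm_subgroup\<close> and of \<open>central\<close>; inversion
      exchanges the two orders.\<close>
    have swap: "a \<otimes> b \<otimes> inv a \<otimes> inv b \<in> N"
      if "b \<otimes> a \<otimes> inv b \<otimes> inv a \<in> N" "a \<in> carrier G" "b \<in> carrier G" for a b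
    proof -
      have "inv (b \<otimes> a \<otimes> inv b \<otimes> inv a) = a \<otimes> b \<otimes> inv a \<otimes> inv b"
        using that by (simp add: inv_mult_group m_assoc)
      then show ?thesis using that(1) N.m_inv_closed by metis
    qed
    let ?Z = "section_centralizer G (carrier G) N"
    have Z: "?Z \<lhd> G"
      using less normal_self normal_section_centralizer by blast
    have "N \<subseteq> ?Z"
      using N.inv_op_closed2 by (auto simp: section_centralizer_def)
    moreover have "g \<in> ?Z"
      using g swap by (simp add: section_centralizer_def)
    moreover have ZG: "?Z \<subseteq> carrier G"
      by (auto simp: section_centralizer_def)
    ultimately have "card N < card ?Z" "card ?Z \<le> card (carrier G)"
      using fin g(2) by (metis finite_subset psubsetI psubset_card_mono, metis card_mono)
    then have "card (carrier G) - card ?Z < card (carrier G) - card N"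
      by linarith
    then obtain n where n: "lower_central G n \<subseteq> ?Z"
      using less(1)[OF _ Z] by blast
    have "lower_central G (Suc n) \<subseteq> N"
      unfolding lower_central.simps comm_subgroup_def
      using n swap by (intro generate_subgroup_incl N.is_subgroup) (auto simp: section_centralizer_def)
    then show ?thesis ..
  qed
qed

lemma (in group) nilpotent_groupI:
  assumes fin: "finite (carrier G)"
    and comm: "\<And>p q x y. Factorial_Ring.prime p \<Longrightarrow> Factorial_Ring.prime q \<Longrightarrow> p \<noteq> q \<Longrightarrow>
      p_element G p x \<Longrightarrow> p_element G q y \<Longrightarrow> x \<otimes> y = y \<otimes> x"
  shows "nilpotent_group G"
proof -
  have "\<exists>g\<in>carrier G. g \<notin> N \<and> (\<forall>x\<in>carrier G. g \<otimes> x \<otimes> inv g \<otimes> inv x \<in> N)"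
    if "N \<lhd> G" "N \<noteq> carrier G" for N
    by (rule central_mod_normal_exists[OF fin _ that]) (rule comm)
  then obtain n where "lower_central G n \<subseteq> {\<one>}"
    using lower_central_reaches_normal[OF fin] one_is_normal by blast
  moreover have "\<one> \<in> lower_central G n"
    by (cases n) (auto simp: comm_subgroup_def generate.one)
  ultimately have "lower_central G n = {\<one>}" by blast
  then show ?thesis
    unfolding nilpotent_group_def using is_group by blast
qed

text \<open>Normalizers grow: a proper subgroup \<open>H\<close> of \<open>K\<close> is strictly
  smaller than its normalizer in \<open>K\<close>, to which the induction applies. The lower central
  series of \<open>G\<close>, cut down to \<open>K\<close>, serves for every
  \<open>K\<close>.\<close>

lemma (in group) nilpotent_group_subnormal_in:
  assumes fin: "finite (carrier G)" and nil: "nilpotent_group G"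
    and K: "subgroup K G" and H: "subgroup H G" "H \<subseteq> K"
  shows "subnormal_in G H K"
  using H
proof (induction "card K - card H" arbitrary: H rule: less_induct)
  case less
  interpret H: subgroup H G by fact
  interpret K: subgroup K G by fact
  have finH: "finite H" and finK: "finite K"
    using fin finite_subgroup less K by auto
  show ?case
  proof (cases "H = K")
    case True
    then show ?thesis using K subnormal_in.refl by blast
  next
    case False
    let ?L = "normalizer G H \<inter> K"
    note norm = normal_in_normalizer[OF fin H.is_subgroup]
    have L: "subgroup ?L G"
      using norm K subgroups_Inter_pair by blast
    obtain n where n: "lower_central G n = {\<one>}"
      using nil by (auto simp: nilpotent_group_def)
    \<comment> \<open>\<open>m\<close> is positive because term 0 meets \<open>K\<close> in all of
      \<open>K\<close>. An \<open>x\<close> of the preceding term in \<open>K\<close> but outside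
      \<open>H\<close> normalizes \<open>H\<close>: its commutators with \<open>H\<close> lie in
      term \<open>m\<close> and in \<open>K\<close>, hence in \<open>H\<close>.\<close>
    define m where "m = (LEAST i. lower_central G i \<inter> K \<subseteq> H)"
    have m: "lower_central G m \<inter> K \<subseteq> H"
      unfolding m_def using n by (rule_tac LeastI[of _ n]) auto
    moreover have "\<not> lower_central G 0 \<inter> K \<subseteq> H"
      using False less.prems K.subset by auto
    ultimately obtain i where i: "m = Suc i" by (cases m) auto
    then have "\<not> lower_central G i \<inter> K \<subseteq> H"
      using not_less_Least[of i "\<lambda>i. lower_central G i \<inter> K \<subseteq> H"] by (simp add: m_def)
    then obtain x where x: "x \<in> lower_central G i" "x \<in> K" "x \<notin> H" by blast
    have "x \<otimes> h \<otimes> inv x \<in> H" if h: "h \<in> H" for h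
    proof -
      have "x \<otimes> h \<otimes> inv x \<otimes> inv h \<in> lower_central G m"
        unfolding i lower_central.simps comm_subgroup_def using x h H.mem_carrier
        by (intro generate.incl UN_I[of x] UN_I[of h]) auto
      then have "x \<otimes> h \<otimes> inv x \<otimes> inv h \<in> H"
        using m x h less.prems by (meson IntI K.m_closed K.m_inv_closed subsetD)
      then have "x \<otimes> h \<otimes> inv x \<otimes> inv h \<otimes> h \<in> H"
        using h by blast
      then show ?thesis using x h by (simp add: m_assoc)
    qed
    then have "x \<in> ?L"
      using x finH H.subset by (simp add: normalizer_iff)
    then have "H \<subset> ?L"
      using norm less.prems x by blast
    moreover have "finite ?L" using finK by blast
    ultimately have "card H < card ?L" "card ?L \<le> card K"
      using psubset_card_mono[of ?L H] card_mono[OF finK, of ?L] by auto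
    then have "card K - card ?L < card K - card H"
      by linarith
    then have "subnormal_in G ?L K"
      using less(1)[OF _ L] by blast
    then show ?thesis
      by (rule subnormal_in_trans_normal)
        (use H.is_subgroup finH H.subset \<open>H \<subset> ?L\<close> in \<open>auto simp: normalizer_iff\<close>)
  qed
qed

subsection \<open>Quasinilpotent groups and the generalized Fitting subgroup\<close>

lemma (in group) subset_set_mult:
  assumes "subgroup H G" "subgroup K G"
  shows "H \<subseteq> H <#> K" "K \<subseteq> H <#> K"
proof -
  interpret H: subgroup H G by fact
  interpret K: subgroup K G by fact
  show "H \<subseteq> H <#> K"
    unfolding set_mult_def using K.one_closed by (force intro: bexI[of _ \<one>])
  show "K \<subseteq> H <#> K"
    unfolding set_mult_def using H.one_closed by (force intro: bexI[of _ \<one>])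
qed

text \<open>Z is central and the members of \<open>\<T>\<close> are minimal normal above Z, so modulo Z the group is a
  join of minimal normal subgroups. Such a group acts on each chief factor by inner automorphisms:
  every T either lies in a given normal subgroup or centralizes it modulo Z.\<close>
lemma (in group) quasinilpotentI:
  assumes Z: "subgroup Z G" "\<And>z x. z \<in> Z \<Longrightarrow> x \<in> carrier G \<Longrightarrow> z \<otimes> x = x \<otimes> z"
    and T: "\<And>T. T \<in> \<T> \<Longrightarrow> T \<lhd> G"
    and minimal: "\<And>T N. T \<in> \<T> \<Longrightarrow> N \<lhd> G \<Longrightarrow> Z \<subseteq> N \<Longrightarrow> N \<subseteq> T \<Longrightarrow> N = Z \<or> N = T"
    and ZT: "\<And>T. T \<in> \<T> \<Longrightarrow> Z \<subseteq> T"
    and gen: "\<And>H. subgroup H G \<Longrightarrow> (\<And>T. T \<in> \<T> \<Longrightarrow> T \<subseteq> H) \<Longrightarrow> H = carrier G"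
  shows "quasinilpotent G"
  unfolding quasinilpotent_def
proof (intro conjI allI impI)
  fix U V assume "chief_factor G U V"
  then have U: "U \<lhd> G" and V: "V \<lhd> G" and "V \<subseteq> U"
    and chief: "\<And>N. N \<lhd> G \<Longrightarrow> V \<subseteq> N \<Longrightarrow> N \<subseteq> U \<Longrightarrow> N = V \<or> N = U"
    by (auto simp: chief_factor_def)
  interpret U: normal U G by fact
  interpret V: normal V G by fact
  interpret Z: subgroup Z G by fact
  have "x \<otimes> z \<otimes> inv x = z" if "x \<in> carrier G" "z \<in> Z" for x z
  proof -
    have "x \<otimes> z \<otimes> inv x = z \<otimes> x \<otimes> inv x"
      using Z(2)[OF that(2,1)] by simp
    then show ?thesis using that by (simp add: m_assoc)
  qed
  then have Zn: "Z \<lhd> G"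
    using Z(1) by (auto simp: normal_inv_iff)
  let ?D = "section_centralizer G U V"
  have D: "subgroup ?D G"
    using U.subset V subgroup_section_centralizer by blast
  have VZ: "V <#> Z \<lhd> G" "V \<subseteq> V <#> Z" "Z \<subseteq> V <#> Z"
    using normal_subgroup_set_mult_closed[OF V Zn] subset_set_mult V.is_subgroup Z.is_subgroup by auto
  have UZ: "U <#> Z \<lhd> G" "U \<subseteq> U <#> Z" "Z \<subseteq> U <#> Z"
    using normal_subgroup_set_mult_closed[OF U Zn] subset_set_mult U.is_subgroup Z.is_subgroup by auto
  have "U <#> ?D = carrier G"
  proof (rule gen)
    show UD: "subgroup (U <#> ?D) G"
      using mult_norm_subgroup[OF U D] .
    have "U \<subseteq> U <#> ?D" "?D \<subseteq> U <#> ?D"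
      using subset_set_mult[OF U.is_subgroup D] by auto
    fix T assume "T \<in> \<T>"
    interpret T: normal T G using T \<open>T \<in> \<T>\<close> by blast
    \<comment> \<open>The chief factor is tested on \<open>U \<inter> (V <#> Z)\<close>, the
      minimality of \<open>T\<close> on \<open>T \<inter> (U <#> Z)\<close>. In the first case
      \<open>U\<close> is \<open>V\<close> up to central factors, so \<open>T\<close> centralizes
      \<open>U/V\<close>; in the second \<open>T\<close> lies in \<open>U <#> Z\<close>, and
      \<open>Z\<close> lies in \<open>?D\<close>; in the third the commutators of \<open>U\<close>
      and \<open>T\<close> lie in \<open>U \<inter> Z\<close>, hence in \<open>V\<close>.\<close>
    consider "U \<subseteq> V <#> Z" | "U \<inter> (V <#> Z) = V" "T \<subseteq> U <#> Z" | "U \<inter> (V <#> Z) = V" "T \<inter> (U <#> Z) = Z"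
    proof -
      have "U \<inter> (V <#> Z) = V \<or> U \<inter> (V <#> Z) = U"
        using chief[of "U \<inter> (V <#> Z)"] normal_subgroup_intersect[OF U VZ(1)] VZ \<open>V \<subseteq> U\<close> by blast
      moreover have "T \<inter> (U <#> Z) = Z \<or> T \<inter> (U <#> Z) = T"
        using minimal[OF \<open>T \<in> \<T>\<close>, of "T \<inter> (U <#> Z)"] normal_subgroup_intersect[OF T.normal_axioms UZ(1)]
          UZ ZT[OF \<open>T \<in> \<T>\<close>] by blast
      ultimately show thesis using that by blast
    qed
    then show "T \<subseteq> U <#> ?D"
    proof cases
      case 1
      have "t \<in> ?D" if t: "t \<in> T" for t
        unfolding section_centralizer_def
      proof (intro CollectI conjI ballI)
        fix a assume "a \<in> U"
        then obtain v z where vz: "v \<in> V" "z \<in> Z" "a = v \<otimes> z"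
          using 1 by (auto simp: set_mult_def)
        have "a \<otimes> t \<otimes> inv a \<otimes> inv t = v \<otimes> (z \<otimes> (t \<otimes> inv z)) \<otimes> inv v \<otimes> inv t"
          using vz t by (simp add: inv_mult_group m_assoc)
        also have "z \<otimes> (t \<otimes> inv z) = t"
          using vz t Z(2)[of z "t \<otimes> inv z"] by (simp add: m_assoc)
        also have "v \<otimes> t \<otimes> inv v \<otimes> inv t = v \<otimes> (t \<otimes> inv v \<otimes> inv t)"
          using vz t by (simp add: m_assoc)
        also have "\<dots> \<in> V"
          using vz t V.inv_op_closed2[of t "inv v"] by simp
        finally show "a \<otimes> t \<otimes> inv a \<otimes> inv t \<in> V" .
      qed (use t in simp)
      then show ?thesis using \<open>?D \<subseteq> U <#> ?D\<close> by blast
    next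
      case 2
      have "a \<otimes> z \<otimes> inv a \<otimes> inv z = \<one>" if "a \<in> U" "z \<in> Z" for a z
        using that Z(2)[of z a] by (simp add: commutator_trivial_iff)
      then have "Z \<subseteq> ?D"
        using V.one_closed by (auto simp: section_centralizer_def)
      then have "U <#> Z \<subseteq> U <#> ?D"
        by (auto simp: set_mult_def)
      then show ?thesis using 2 by blast
    next
      case 3
      have "t \<in> ?D" if t: "t \<in> T" for t
        unfolding section_centralizer_def
      proof (intro CollectI conjI ballI)
        fix a assume a: "a \<in> U"
        let ?c = "a \<otimes> t \<otimes> inv a \<otimes> inv t"
        have "?c \<in> T"
          using a t T.inv_op_closed2[of a t] by simp
        moreover have "a \<otimes> (t \<otimes> inv a \<otimes> inv t) \<in> U"
          using a t U.inv_op_closed2[of t "inv a"] by simp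
        then have "?c \<in> U"
          using a t by (simp add: m_assoc)
        ultimately show "?c \<in> V"
          using 3 UZ VZ by blast
      qed (use t in simp)
      then show ?thesis using \<open>?D \<subseteq> U <#> ?D\<close> by blast
    qed
  qed
  then show "carrier G = U <#> ?D" ..
qed (rule is_group)

lemma (in group) normal_conj:
  assumes A: "A \<lhd> G" and T: "T \<lhd> G\<lparr>carrier := A\<rparr>" and g: "g \<in> carrier G"
  shows "(\<lambda>x. g \<otimes> x \<otimes> inv g) ` T \<lhd> G\<lparr>carrier := A\<rparr>"
proof -
  interpret A: normal A G by fact
  have T: "subgroup T G" "T \<subseteq> A" "\<And>x t. x \<in> A \<Longrightarrow> t \<in> T \<Longrightarrow> x \<otimes> t \<otimes> inv x \<in> T"
    using T by (auto simp: normal_in_subgroup_iff[OF A.is_subgroup])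
  have "x \<otimes> (g \<otimes> t \<otimes> inv g) \<otimes> inv x \<in> (\<lambda>x. g \<otimes> x \<otimes> inv g) ` T" if x: "x \<in> A" and t: "t \<in> T" for x t
  proof -
    let ?x = "inv g \<otimes> x \<otimes> g"
    have tA: "t \<in> A" using t T by blast
    have "?x \<in> A" using x g A.inv_op_closed1 by blast
    then have "?x \<otimes> t \<otimes> inv ?x \<in> T" using T t by blast
    moreover have "x \<otimes> (g \<otimes> t \<otimes> inv g) \<otimes> inv x = g \<otimes> (?x \<otimes> t \<otimes> inv ?x) \<otimes> inv g"
      using g x tA by (simp add: inv_mult_group m_assoc)
    ultimately show ?thesis by blast
  qed
  then show ?thesis
    unfolding normal_in_subgroup_iff[OF A.is_subgroup]
    using subgroup_conj[OF T(1) g] T(2) g A.inv_op_closed2 by auto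
qed

text \<open>The join of the members of \<open>\<T>\<close> is invariant under \<open>G\<close> and
  strictly contains \<open>Z\<close>, so it is all of \<open>A\<close> because \<open>A/Z\<close> is
  a chief factor of \<open>G\<close>. This is the generation hypothesis of
  \<open>quasinilpotentI\<close>.\<close>

lemma (in group) central_chief_factor_quasinilpotent:
  assumes fin: "finite (carrier G)" and chief: "chief_factor G A Z"
    and central: "\<And>z a. z \<in> Z \<Longrightarrow> a \<in> A \<Longrightarrow> z \<otimes> a = a \<otimes> z"
  shows "quasinilpotent (G\<lparr>carrier := A\<rparr>)"
proof -
  have A: "A \<lhd> G" and Z: "Z \<lhd> G" "Z \<subset> A"
    and minA: "\<And>N. N \<lhd> G \<Longrightarrow> Z \<subseteq> N \<Longrightarrow> N \<subseteq> A \<Longrightarrow> N = Z \<or> N = A"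
    using chief by (auto simp: chief_factor_def)
  interpret A: normal A G by fact
  interpret Z: normal Z G by fact
  interpret GA: group "G\<lparr>carrier := A\<rparr>"
    using A.is_subgroup subgroup_imp_group by blast
  note normal_iff = normal_in_subgroup_iff[OF A.is_subgroup]
  have finA: "finite A" using fin A.is_subgroup finite_subgroup by blast
  \<comment> \<open>Least order is used rather than minimality under inclusion: conjugation
    preserves the order, so \<open>\<T>\<close> is closed under \<open>G\<close>, and a normal
    subgroup of \<open>A\<close> strictly below a member of \<open>\<T>\<close> and above
    \<open>Z\<close> has order below \<open>m\<close> and must be \<open>Z\<close>.\<close>
  define m where "m = (LEAST k. \<exists>T. T \<lhd> G\<lparr>carrier := A\<rparr> \<and> Z \<subset> T \<and> card T = k)"
  define \<T> where "\<T> = {T. T \<lhd> G\<lparr>carrier := A\<rparr> \<and> Z \<subset> T \<and> card T = m}"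
  have "A \<lhd> G\<lparr>carrier := A\<rparr>"
    using GA.normal_self by simp
  then have "\<exists>k T. T \<lhd> G\<lparr>carrier := A\<rparr> \<and> Z \<subset> T \<and> card T = k"
    using Z by blast
  then have ex: "\<exists>T. T \<in> \<T>"
    using LeastI_ex[of "\<lambda>k. \<exists>T. T \<lhd> G\<lparr>carrier := A\<rparr> \<and> Z \<subset> T \<and> card T = k"]
    by (simp add: \<T>_def m_def)
  have m_le: "m \<le> card N" if "N \<lhd> G\<lparr>carrier := A\<rparr>" "Z \<subset> N" for N
    unfolding m_def using that by (intro Least_le) blast
  have TA: "T \<subseteq> A" if "T \<in> \<T>" for T
    using that by (auto simp: \<T>_def normal_iff)
  have conj: "(\<lambda>x. g \<otimes> x \<otimes> inv g) ` T \<in> \<T>" if T: "T \<in> \<T>" and g: "g \<in> carrier G" for g T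
  proof -
    let ?T = "(\<lambda>x. g \<otimes> x \<otimes> inv g) ` T"
    have n: "T \<lhd> G\<lparr>carrier := A\<rparr>" "Z \<subset> T" "card T = m"
      using T by (auto simp: \<T>_def)
    have "T \<subseteq> carrier G" using TA[OF T] A.subset by blast
    then have card: "card ?T = m"
      using n g by (simp add: card_image inj_on_conj)
    have "Z \<subseteq> ?T"
    proof
      fix z assume z: "z \<in> Z"
      then have "inv g \<otimes> z \<otimes> g \<in> T"
        using n g Z.inv_op_closed1 by blast
      moreover have "z = g \<otimes> (inv g \<otimes> z \<otimes> g) \<otimes> inv g"
        using z g by (simp add: conj_m_inv_cancel)
      ultimately show "z \<in> ?T" by blast
    qed
    moreover have "card Z < card T"
      using n TA[OF T] finA finite_subset psubset_card_mono by metis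
    ultimately have "Z \<subset> ?T" using card n by auto
    then show ?thesis
      using normal_conj[OF A n(1) g] card by (simp add: \<T>_def)
  qed
  show ?thesis
  proof (rule GA.quasinilpotentI)
    show "subgroup Z (G\<lparr>carrier := A\<rparr>)"
      using Z Z.is_subgroup A.is_subgroup subgroup_incl by blast
    show "T \<lhd> G\<lparr>carrier := A\<rparr>" "Z \<subseteq> T" if "T \<in> \<T>" for T
      using that by (auto simp: \<T>_def)
    show "N = Z \<or> N = T" if "T \<in> \<T>" "N \<lhd> G\<lparr>carrier := A\<rparr>" "Z \<subseteq> N" "N \<subseteq> T" for T N
    proof (rule disjCI)
      assume "N \<noteq> T"
      moreover have "finite T" using TA that(1) finA finite_subset by blast
      ultimately have "card N < m"
        using that psubset_card_mono[of T N] by (auto simp: \<T>_def)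
      then show "N = Z" using m_le[of N] that by fastforce
    qed
    fix H assume H: "subgroup H (G\<lparr>carrier := A\<rparr>)" and TH: "\<And>T. T \<in> \<T> \<Longrightarrow> T \<subseteq> H"
    let ?J = "generate G (\<Union>\<T>)"
    have TG: "\<Union>\<T> \<subseteq> carrier G" using TA A.subset by blast
    have "?J \<lhd> G"
      using conj by (intro normal_generateI TG) blast
    moreover have "\<Union>\<T> \<subseteq> ?J" using generate.incl[of _ "\<Union>\<T>" G] by (rule subsetI)
    moreover obtain T where "T \<in> \<T>" using ex by blast
    ultimately have "Z \<subset> ?J" by (auto simp: \<T>_def)
    moreover have "?J \<subseteq> A"
      using TA A.is_subgroup by (intro generate_subgroup_incl) auto
    ultimately have "?J = A"
      using minA[OF \<open>?J \<lhd> G\<close>] by blast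
    moreover have "?J \<subseteq> H"
      using TH H A.is_subgroup incl_subgroup by (intro generate_subgroup_incl) blast+
    ultimately show "H = carrier (G\<lparr>carrier := A\<rparr>)"
      using subgroup.subset[OF H] by auto
  qed (use central in auto)
qed

section \<open>The generalized Fitting subgroup and its centralizer\<close>

lemma (in group) normal_gen_fitting: "gen_fitting G \<lhd> G"
  unfolding gen_fitting_def
proof (rule normal_generateI)
  show "\<Union>{N. N \<lhd> G \<and> quasinilpotent (G\<lparr>carrier := N\<rparr>)} \<subseteq> carrier G"
    using normal_imp_subgroup subgroup.subset by blast
  fix h g assume "h \<in> \<Union>{N. N \<lhd> G \<and> quasinilpotent (G\<lparr>carrier := N\<rparr>)}" and g: "g \<in> carrier G"
  then obtain N where N: "N \<lhd> G" "quasinilpotent (G\<lparr>carrier := N\<rparr>)" "h \<in> N" by blast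
  then have "g \<otimes> h \<otimes> inv g \<in> N" using normal.inv_op_closed2 g by fast
  with N show "g \<otimes> h \<otimes> inv g \<in> \<Union>{N. N \<lhd> G \<and> quasinilpotent (G\<lparr>carrier := N\<rparr>)}" by blast
qed

lemma (in group) subset_gen_fitting:
  assumes "N \<lhd> G" "quasinilpotent (G\<lparr>carrier := N\<rparr>)"
  shows "N \<subseteq> gen_fitting G"
proof
  fix x assume "x \<in> N"
  with assms have "x \<in> \<Union>{N. N \<lhd> G \<and> quasinilpotent (G\<lparr>carrier := N\<rparr>)}" by blast
  then show "x \<in> gen_fitting G" unfolding gen_fitting_def by (rule generate.incl)
qed

lemma (in group) centralizer_gen_fitting:
  assumes fin: "finite (carrier G)"
  shows "section_centralizer G (gen_fitting G) {\<one>} \<subseteq> gen_fitting G" (is "?C \<subseteq> ?F")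
proof (rule ccontr)
  assume not: "\<not> ?C \<subseteq> ?F"
  let ?Z = "?C \<inter> ?F"
  interpret F: normal ?F G by (rule normal_gen_fitting)
  have C: "?C \<lhd> G"
    using F.normal_axioms one_is_normal normal_section_centralizer by blast
  then have Z: "?Z \<lhd> G"
    using F.normal_axioms normal_subgroup_intersect by blast
  have comm: "f \<otimes> c = c \<otimes> f" if "f \<in> ?F" "c \<in> ?C" for f c
    using that commutator_trivial_iff[of f c] by (simp add: section_centralizer_def)
  define P where "P A \<longleftrightarrow> A \<lhd> G \<and> ?Z \<subset> A \<and> A \<subseteq> ?C" for A
  have "P ?C" using C not by (auto simp: P_def)
  \<comment> \<open>Least order leaves no normal subgroup of \<open>G\<close> strictly between
    \<open>?Z\<close> and \<open>A\<close>, so \<open>A/?Z\<close> is a chief factor. Being inside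
    \<open>?C\<close>, \<open>A\<close> commutes with \<open>?Z\<close>, which lies in
    \<open>?F\<close>.\<close>
  then obtain A where A: "P A" and least: "\<And>B. P B \<Longrightarrow> card A \<le> card B"
    using ex_has_least_nat[of P _ card] by blast
  have "finite A"
    using A fin normal_imp_subgroup finite_subgroup by (metis P_def)
  have "chief_factor G A ?Z"
    unfolding chief_factor_def
  proof (intro conjI allI impI)
    fix N assume N: "N \<lhd> G" "?Z \<subseteq> N" "N \<subseteq> A"
    show "N = ?Z \<or> N = A"
    proof (rule disjCI)
      assume "N \<noteq> A"
      then have "card N < card A"
        using N \<open>finite A\<close> psubset_card_mono by blast
      then show "N = ?Z" using least[of N] N A by (auto simp: P_def)
    qed
  qed (use A Z in \<open>auto simp: P_def\<close>)
  then have "quasinilpotent (G\<lparr>carrier := A\<rparr>)"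
    using A comm by (intro central_chief_factor_quasinilpotent[OF fin]) (auto simp: P_def)
  then have "A \<subseteq> ?F" using A subset_gen_fitting by (simp add: P_def)
  then show False using A by (auto simp: P_def)
qed

subsection \<open>Subnormality relative to a normal subgroup\<close>

text \<open>Isolates what is asked of the generalized Fitting subgroup: normality, containing its
  own centralizer, and normalizing all Sylow subgroups.\<close>

lemma (in group) nilpotent_groupI_normal_self_centralizing:
  assumes fin: "finite (carrier G)" and F: "F \<lhd> G"
    and self: "section_centralizer G F {\<one>} \<subseteq> F"
    and norm: "\<And>p P. sylow_subgroup G p P \<Longrightarrow> F \<subseteq> normalizer G P"
  shows "nilpotent_group G"
proof -
  interpret F: normal F G by fact
  have P: "subgroup P G" "finite P" "P \<subseteq> carrier G" if "sylow_subgroup G p P" for p P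
    using that fin finite_subgroup subgroup.subset by (auto simp: sylow_subgroup_def)
  have conjF: "f \<otimes> x \<otimes> inv f \<in> P" if "sylow_subgroup G p P" "f \<in> F" "x \<in> P" for p P f x
    using norm[OF that(1)] that P[OF that(1)] by (auto simp: normalizer_iff)
  have mem: "y \<in> Q" if "sylow_subgroup G q Q" "p_element G q y" "y \<in> normalizer G Q" for q Q y
    using p_element_normalizing_sylow_subgroup fin that by blast
  have comm: "x \<otimes> y = y \<otimes> x"
    if pq: "Factorial_Ring.prime p" "Factorial_Ring.prime q" "p \<noteq> q"
      and x: "p_element G p x" and y: "p_element G q y" "y \<in> F" for p q x y
  proof -
    have [simp]: "x \<in> carrier G" using x by (simp add: p_element_def)
    obtain R where R: "sylow_subgroup G p R" "x \<in> R"
      using p_element_in_sylow_subgroup fin pq x by metis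
    obtain Q where Q: "sylow_subgroup G q Q"
      using sylow_subgroup_exists fin pq by blast
    let ?c = "x \<otimes> y \<otimes> inv x \<otimes> inv y"
    \<comment> \<open>As an element of \<open>F\<close>, \<open>y\<close> normalizes
      \<open>R\<close>, which puts \<open>?c\<close> into \<open>R\<close>. Both \<open>y\<close>
      and its conjugate by \<open>x\<close> are q-elements of \<open>F\<close>, so they normalize
      \<open>Q\<close> and lie in it, which puts \<open>?c\<close> into \<open>Q\<close>.\<close>
    have "x \<otimes> (y \<otimes> inv x \<otimes> inv y) \<in> R"
      using R y conjF P(1)[OF R(1)] by (simp add: subgroup.m_closed subgroup.m_inv_closed)
    then have "p_element G p ?c"
      using R y sylow_subgroup_p_element by (simp add: m_assoc)
    moreover have "x \<otimes> y \<otimes> inv x \<in> F"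
      using y F.inv_op_closed2[of x y] by simp
    then have "x \<otimes> y \<otimes> inv x \<in> Q" "y \<in> Q"
      using mem[OF Q] p_element_conj[OF y(1), of x] y norm[OF Q] by auto
    then have "?c \<in> Q"
      using P(1)[OF Q] by (simp add: subgroup.m_closed subgroup.m_inv_closed)
    then have "p_element G q ?c"
      by (rule sylow_subgroup_p_element[OF Q])
    ultimately have "?c = \<one>"
      using p_element_q_element_trivial pq by blast
    then show ?thesis using y commutator_trivial_iff by simp
  qed
  have fix_conj: "a \<otimes> z \<otimes> inv a = z" "inv a \<otimes> z \<otimes> a = z"
    if "a \<in> carrier G" "z \<in> carrier G" "a \<otimes> z = z \<otimes> a" for a z
    using that by (simp add: m_assoc, simp add: m_assoc flip: that(3))
  have commutator_central: "x \<otimes> y \<otimes> inv x \<otimes> inv y \<in> section_centralizer G F {\<one>}"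
    if pq: "Factorial_Ring.prime p" "Factorial_Ring.prime q" "p \<noteq> q"
      and x: "p_element G p x" and y: "p_element G q y" for p q x y
  proof -
    let ?c = "x \<otimes> y \<otimes> inv x \<otimes> inv y"
    have xG: "x \<in> carrier G" and yG: "y \<in> carrier G" using x y by (simp_all add: p_element_def)
    have "F \<subseteq> section_centralizer G {?c} {\<one>}"
    proof (rule subgroup_containing_p_elements[OF fin _ F.is_subgroup])
      show "subgroup (section_centralizer G {?c} {\<one>}) G"
        using xG yG one_is_normal by (intro subgroup_section_centralizer) auto
      fix r z assume r: "Factorial_Ring.prime r" and z: "p_element G r z" "z \<in> F"
      \<comment> \<open>This is conjugation of \<open>z\<close> by \<open>?c\<close>, unfolded. If r
        differs from q, \<open>y\<close> fixes both \<open>z\<close> and its conjugate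
        \<open>?w\<close>, leaving conjugation by \<open>inv x\<close> and then \<open>x\<close>; if
        r is q, it differs from p and the roles are exchanged.\<close>
      have *: "x \<otimes> (y \<otimes> (inv x \<otimes> (inv y \<otimes> z \<otimes> y) \<otimes> x) \<otimes> inv y) \<otimes> inv x = z"
      proof (cases "r = q")
        case False
        let ?w = "inv x \<otimes> z \<otimes> x"
        have "p_element G r ?w" "?w \<in> F"
          using p_element_conj[OF z(1), of "inv x"] z xG F.inv_op_closed1 by auto
        then have "y \<otimes> ?w \<otimes> inv y = ?w" "inv y \<otimes> z \<otimes> y = z"
          using comm[OF pq(2) r _ y] False z fix_conj[OF yG] by auto
        then show ?thesis
          using z(2) xG by (simp only: conj_m_inv_cancel F.mem_carrier)
      next
        case True
        let ?w = "inv y \<otimes> z \<otimes> y"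
        have "p_element G r ?w" "?w \<in> F"
          using p_element_conj[OF z(1), of "inv y"] z yG F.inv_op_closed1 by auto
        then have "inv x \<otimes> ?w \<otimes> x = ?w" "x \<otimes> z \<otimes> inv x = z"
          using comm[OF pq(1) r _ x] True pq(3) z fix_conj[OF xG] by auto
        then show ?thesis
          using z(2) yG by (simp only: conj_m_inv_cancel F.mem_carrier)
      qed
      have "?c \<otimes> z \<otimes> inv ?c = z"
        using * xG yG z(2) by (simp add: inv_mult_group m_assoc)
      then show "z \<in> section_centralizer G {?c} {\<one>}"
        using xG yG z(2) by (simp add: section_centralizer_def)
    qed
    then have "?c \<otimes> f = f \<otimes> ?c" if "f \<in> F" for f
      using that xG yG by (subst commutator_trivial_iff[symmetric]) (auto simp: section_centralizer_def)
    then show ?thesis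
      using xG yG by (auto simp: section_centralizer_def commutator_trivial_iff)
  qed
  have normal: "normalizer G Q = carrier G" if Q: "sylow_subgroup G q Q" for q Q
  proof (rule subgroup_eq_carrierI[OF fin])
    show N: "subgroup (normalizer G Q) G"
      using normal_in_normalizer(1)[OF fin] P[OF Q] by blast
    fix p :: nat assume p: "Factorial_Ring.prime p"
    have q: "Factorial_Ring.prime q" using Q by (simp add: sylow_subgroup_def)
    show "\<exists>P. sylow_subgroup G p P \<and> P \<subseteq> normalizer G Q"
    proof (cases "p = q")
      case True
      then show ?thesis using Q P[OF Q] normal_in_normalizer(2)[OF fin] by blast
    next
      case False
      obtain R where R: "sylow_subgroup G p R"
        using sylow_subgroup_exists fin p by blast
      have "x \<otimes> y \<otimes> inv x \<in> Q" if x: "x \<in> R" and y: "y \<in> Q" for x y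
      proof (rule mem[OF Q])
        have p_el: "p_element G p x" "p_element G q y"
          using Q R x y sylow_subgroup_p_element by auto
        then have xy: "x \<in> carrier G" "y \<in> carrier G" by (auto simp: p_element_def)
        then show "p_element G q (x \<otimes> y \<otimes> inv x)"
          using p_el p_element_conj by blast
        \<comment> \<open>The commutator centralizes \<open>F\<close>, hence lies in
          \<open>F\<close>, which normalizes \<open>Q\<close>. Multiplying by \<open>y\<close> shows
          that the conjugate of \<open>y\<close> by \<open>x\<close> normalizes \<open>Q\<close>; as
          a q-element it then lies in \<open>Q\<close>.\<close>
        have "x \<otimes> y \<otimes> inv x \<otimes> inv y \<in> normalizer G Q"
          using commutator_central[OF p q False p_el] self norm[OF Q] by blast
        moreover have "y \<in> normalizer G Q"
          using y P[OF Q] normal_in_normalizer(2)[OF fin] by blast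
        ultimately have "x \<otimes> y \<otimes> inv x \<otimes> inv y \<otimes> y \<in> normalizer G Q"
          using subgroup.m_closed[OF N] by blast
        then show "x \<otimes> y \<otimes> inv x \<in> normalizer G Q"
          using xy by (simp add: m_assoc)
      qed
      then have "R \<subseteq> normalizer G Q"
        using P[OF R] P[OF Q] by (auto simp: normalizer_iff)
      with R show ?thesis by blast
    qed
  qed
  show ?thesis
  proof (rule nilpotent_groupI[OF fin])
    fix p q x y
    assume pq: "Factorial_Ring.prime p" "Factorial_Ring.prime q" "p \<noteq> q"
      and x: "p_element G p x" and y: "p_element G q y"
    then have xy: "x \<in> carrier G" "y \<in> carrier G" by (auto simp: p_element_def)
    obtain R where R: "sylow_subgroup G p R" "x \<in> R"
      using p_element_in_sylow_subgroup fin pq x by metis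
    obtain Q where Q: "sylow_subgroup G q Q" "y \<in> Q"
      using p_element_in_sylow_subgroup fin pq y by metis
    let ?c = "x \<otimes> y \<otimes> inv x \<otimes> inv y"
    have "x \<otimes> (y \<otimes> inv x \<otimes> inv y) \<in> R"
      using R xy normal[OF R(1)] P[OF R(1)]
      by (metis normalizer_iff subgroup.m_closed subgroup.m_inv_closed)
    moreover have "x \<otimes> y \<otimes> inv x \<otimes> inv y \<in> Q"
      using Q xy normal[OF Q(1)] P[OF Q(1)]
      by (metis normalizer_iff subgroup.m_closed subgroup.m_inv_closed)
    ultimately have "p_element G p ?c" "p_element G q ?c"
      using R Q xy sylow_subgroup_p_element by (auto simp: m_assoc)
    then have "?c = \<one>"
      using p_element_q_element_trivial pq by blast
    then show "x \<otimes> y = y \<otimes> x" using xy commutator_trivial_iff by blast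
  qed
qed

lemma (in group) nilpotent_groupI_gen_fitting:
  assumes "finite (carrier G)"
    and "\<And>p P. sylow_subgroup G p P \<Longrightarrow> gen_fitting G \<subseteq> normalizer G P"
  shows "nilpotent_group G"
  using nilpotent_groupI_normal_self_centralizing[OF assms(1) normal_gen_fitting]
    centralizer_gen_fitting assms by blast

section \<open>Consequences of nilpotency, and how each condition makes F normalize the Sylow
  subgroups\<close>

lemma (in group) nilpotent_group_R_subnormal:
  assumes "finite (carrier G)" "nilpotent_group G" "R \<subseteq> carrier G" "subgroup H G"
  shows "R_subnormal G R H"
  unfolding R_subnormal_def
  using assms subgroup.subset[of H G]
  by (intro nilpotent_group_subnormal_in generate_is_subgroup) (simp_all add: generate.incl subsetI)

lemma (in group) R_subnormal_self_normalizing: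
  assumes "R \<subseteq> carrier G" "R_subnormal G R H" "H \<subseteq> carrier G"
    and self: "\<And>g. g \<in> carrier G \<Longrightarrow> \<forall>h\<in>H. g \<otimes> h \<otimes> inv g \<in> H \<Longrightarrow> g \<in> H"
  shows "R \<subseteq> H"
proof -
  have "generate G (H \<union> R) \<subseteq> carrier G"
    using assms by (intro generate_incl) blast
  then have "H = generate G (H \<union> R)"
    using subnormal_in_self_normalizing[of H "generate G (H \<union> R)"] self assms(2)
    by (auto simp: R_subnormal_def)
  then show ?thesis using generate.incl[of _ "H \<union> R" G] by blast
qed

text \<open>A Frattini argument. In the join \<open>?J\<close> of the normalizer and its conjugate,
  \<open>?Pg\<close> is taken into the Sylow subgroup \<open>P\<close> by some \<open>a\<close> of
  \<open>?J\<close>. Then \<open>a \<otimes> inv g\<close> normalizes \<open>P\<close> and so lies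
  in \<open>?J\<close>, and therefore \<open>g\<close> does too.\<close>

lemma (in group) abnormal_normalizer_sylow_subgroup:
  assumes fin: "finite (carrier G)" and P: "sylow_subgroup G p P"
  shows "abnormal G (normalizer G P)"
  unfolding abnormal_def
proof (intro conjI ballI)
  have subP: "subgroup P G" "finite P" "P \<subseteq> carrier G"
    using P fin finite_subgroup subgroup.subset by (auto simp: sylow_subgroup_def)
  let ?N = "normalizer G P"
  note N = normal_in_normalizer[OF fin subP(1)]
  have NG: "?N \<subseteq> carrier G" using N subgroup.subset by blast
  show "subgroup ?N G" by fact
  fix g assume g: "g \<in> carrier G"
  let ?Ng = "inv g <# ?N #> g" and ?Pg = "(\<lambda>x. inv g \<otimes> x \<otimes> inv (inv g)) ` P"
  let ?J = "generate G (?N \<union> ?Ng)"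
  have NgG: "?N \<union> ?Ng \<subseteq> carrier G"
    using g NG by (simp add: l_coset_subset_G r_coset_subset_G)
  have J: "subgroup ?J G" using NgG generate_is_subgroup by blast
  interpret J: group "G\<lparr>carrier := ?J\<rparr>" using J subgroup_imp_group by blast
  have NJ: "?N \<subseteq> ?J" "?Ng \<subseteq> ?J" using generate.incl[of _ "?N \<union> ?Ng" G] by blast+
  have "P \<subseteq> ?J" using N NJ by blast
  have "?Pg \<subseteq> ?Ng" using g N(2) by (force simp: l_coset_def r_coset_def)
  then have "?Pg \<subseteq> ?J" using NJ by blast
  have "subgroup ?Pg G" "card ?Pg = card P"
    using sylow_subgroup_conj[OF P, of "inv g"] g P by (auto simp: sylow_subgroup_def)
  moreover have "sylow_subgroup (G\<lparr>carrier := ?J\<rparr>) p P"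
    using sylow_subgroup_in_subgroup fin P J \<open>P \<subseteq> ?J\<close> by blast
  moreover have "finite ?J" using J fin finite_subgroup by blast
  ultimately obtain a where a: "a \<in> ?J" "\<And>h. h \<in> ?Pg \<Longrightarrow> a \<otimes> h \<otimes> inv a \<in> P"
    using J.sylow_subgroup_conj_contains[of p P ?Pg "multiplicity p (order G)"]
      subgroup_incl[OF _ J \<open>?Pg \<subseteq> ?J\<close>] P J by (auto simp: sylow_subgroup_def)
  have aG: "a \<in> carrier G" using a J subgroup.mem_carrier by fast
  have "a \<otimes> inv g \<otimes> x \<otimes> inv (a \<otimes> inv g) \<in> P" if x: "x \<in> P" for x
  proof -
    have "x \<in> carrier G" using x subP by blast
    then have "a \<otimes> inv g \<otimes> x \<otimes> inv (a \<otimes> inv g) = a \<otimes> (inv g \<otimes> x \<otimes> inv (inv g)) \<otimes> inv a"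
      using aG g by (simp add: inv_mult_group m_assoc)
    then show ?thesis using a x by auto
  qed
  then have "a \<otimes> inv g \<in> ?J"
    using aG g subP NJ by (auto simp: normalizer_iff)
  then have "inv (a \<otimes> inv g) \<otimes> a \<in> ?J"
    using a(1) J subgroup.m_closed subgroup.m_inv_closed by metis
  then show "g \<in> ?J"
    using aG g by (simp add: inv_mult_group m_assoc)
qed

text \<open>Being a subnormal p-group, \<open>P\<close> lies in every Sylow p-subgroup of its join
  with \<open>R\<close>, in particular in its own conjugate by \<open>inv f\<close>; read backwards,
  conjugation by \<open>f\<close> maps \<open>P\<close> into \<open>P\<close>.\<close>

lemma (in group) sylow_R_subnormal_normalizer:
  assumes fin: "finite (carrier G)" and P: "sylow_subgroup G p P"
    and R: "R \<subseteq> carrier G" and sub: "R_subnormal G R P"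
  shows "R \<subseteq> normalizer G P"
proof
  fix f assume f: "f \<in> R"
  then have fG: "f \<in> carrier G" using R by blast
  have subP: "subgroup P G" "finite P" "P \<subseteq> carrier G" "card P = p ^ multiplicity p (order G)"
    using P fin finite_subgroup subgroup.subset by (auto simp: sylow_subgroup_def)
  let ?K = "generate G (P \<union> R)"
  have K: "subgroup ?K G" using subP R generate_is_subgroup by simp
  interpret K: group "G\<lparr>carrier := ?K\<rparr>" using K subgroup_imp_group by blast
  have PK: "P \<subseteq> ?K" and fK: "f \<in> ?K" using f by (auto intro: generate.incl)
  have "sylow_subgroup (G\<lparr>carrier := ?K\<rparr>) p ((\<lambda>x. inv f \<otimes> x \<otimes> inv (inv f)) ` P)"
    using K.sylow_subgroup_conj[OF sylow_subgroup_in_subgroup[OF fin P K PK], of "inv f"] K fK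
    by (simp add: subgroup.m_inv_closed)
  then have "P \<subseteq> (\<lambda>x. inv f \<otimes> x \<otimes> inv (inv f)) ` P"
    using subnormal_in_sylow_subgroup[OF fin _ _ subP(4)] sub by (simp add: R_subnormal_def)
  then have "f \<otimes> x \<otimes> inv f \<in> P" if x: "x \<in> P" for x
  proof -
    obtain y where y: "y \<in> P" "x = inv f \<otimes> y \<otimes> inv (inv f)"
      using x \<open>P \<subseteq> _ ` P\<close> by blast
    then show ?thesis using fG subP by (auto simp: conj_m_inv_cancel)
  qed
  then show "f \<in> normalizer G P"
    using fG subP by (simp add: normalizer_iff)
qed

lemma (in group) subnormal_in_trans:
  assumes "subnormal_in G H L" "subnormal_in G L K"
  shows "subnormal_in G H K"
  using assms
proof induction
  case (step H M L)
  then show ?case using subnormal_in.step by metis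
qed

lemma (in group) cyclic_primary_R_subnormal_normalizer:
  assumes fin: "finite (carrier G)" and F: "F \<lhd> G"
    and sub: "\<And>H. cyclic_primary G H \<Longrightarrow> R_subnormal G F H"
    and P: "sylow_subgroup G p P"
  shows "F \<subseteq> normalizer G P"
proof -
  interpret F: normal F G by fact
  have cyc: "R_subnormal G F (generate G {x})" "\<exists>k. card (generate G {x}) = r ^ k"
    if "Factorial_Ring.prime r" "p_element G r x" for r x
  proof -
    show "\<exists>k. card (generate G {x}) = r ^ k"
      using card_generate_p_element[OF fin that] by metis
    then show "R_subnormal G F (generate G {x})"
      using that by (intro sub) (auto simp: cyclic_primary_def p_element_def)
  qed
  have mem: "x \<in> S"
    if mem_prems: "sylow_subgroup (G\<lparr>carrier := K\<rparr>) r S" "p_element G r x" "subnormal_in G (generate G {x}) K"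
    for r S x K
  proof -
    obtain k where "card (generate G {x}) = r ^ k"
      using mem_prems(1,2) cyc(2) by (auto simp: sylow_subgroup_def)
    then have "generate G {x} \<subseteq> S"
      using subnormal_in_sylow_subgroup fin mem_prems by blast
    then show ?thesis using generate.incl[of x "{x}" G] by blast
  qed
  \<comment> \<open>For \<open>y\<close> in \<open>F\<close> the join with \<open>F\<close> is
    \<open>F\<close> itself, so \<open>generate G {y}\<close> is subnormal in \<open>F\<close> and,
    as \<open>F\<close> is normal, in \<open>G\<close>.\<close>
  have memF: "y \<in> Q" if Q: "sylow_subgroup G q Q" and y: "p_element G q y" "y \<in> F" for q Q y
  proof -
    have "generate G {y} \<subseteq> F"
      using y F.is_subgroup by (intro generate_subgroup_incl) auto
    then have "generate G (generate G {y} \<union> F) = F"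
      using F.is_subgroup generate_subgroup_incl[of "generate G {y} \<union> F" F]
        generate.incl[of _ "generate G {y} \<union> F" G] by blast
    then have "subnormal_in G (generate G {y}) F"
      using cyc(1)[of q y] Q y by (simp add: R_subnormal_def sylow_subgroup_def)
    moreover have "subnormal_in G F (carrier G)"
      using F subgroup_self by (intro subnormal_in.step[OF _ subnormal_in.refl]) simp_all
    ultimately have "subnormal_in G (generate G {y}) (carrier G)"
      using subnormal_in_trans by blast
    then show ?thesis using mem[of "carrier G" q Q y] Q y by simp
  qed
  have comm: "x \<otimes> y = y \<otimes> x"
    if pq: "Factorial_Ring.prime p" "Factorial_Ring.prime q" "p \<noteq> q"
      and x: "p_element G p x" and y: "p_element G q y" "y \<in> F" for p q x y
  proof -
    have xG: "x \<in> carrier G" using x by (simp add: p_element_def)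
    let ?H = "generate G {x}" and ?c = "x \<otimes> y \<otimes> inv x \<otimes> inv y"
    let ?K = "generate G (?H \<union> F)"
    have "?H \<subseteq> carrier G" using xG generate_incl by simp
    then have K: "subgroup ?K G" using F.subset generate_is_subgroup by simp
    interpret K: group "G\<lparr>carrier := ?K\<rparr>" using K subgroup_imp_group by blast
    have finK: "finite ?K" using K fin finite_subgroup by blast
    have xy: "x \<in> ?K" "y \<in> ?K" using y by (auto intro!: generate.incl)
    have subn: "subnormal_in G ?H ?K" using cyc(1) pq x by (simp add: R_subnormal_def)
    obtain S where S: "sylow_subgroup (G\<lparr>carrier := ?K\<rparr>) p S"
      using K.sylow_subgroup_exists pq(1) finK by auto
    then have subS: "subgroup S G" using incl_subgroup[OF K] by (simp add: sylow_subgroup_def)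
    have "x \<in> S" using mem[OF S x subn] .
    \<comment> \<open>\<open>x\<close> lies in every Sylow p-subgroup of \<open>?K\<close>, so also
      in the conjugate of \<open>S\<close> by \<open>inv y\<close>. Thus \<open>S\<close> contains
      both \<open>x\<close> and its conjugate by \<open>y\<close>, and with them
      \<open>?c\<close>.\<close>
    have "sylow_subgroup (G\<lparr>carrier := ?K\<rparr>) p ((\<lambda>x. inv y \<otimes> x \<otimes> inv (inv y)) ` S)"
      using K.sylow_subgroup_conj[OF S, of "inv y"] K xy by (simp add: subgroup.m_inv_closed)
    then obtain s where s: "s \<in> S" "x = inv y \<otimes> s \<otimes> inv (inv y)"
      using mem[OF _ x subn] by blast
    then have "y \<otimes> x \<otimes> inv y \<in> S"
      using y subgroup.mem_carrier[OF subS] by (simp add: conj_m_inv_cancel)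
    then have "x \<otimes> inv (y \<otimes> x \<otimes> inv y) \<in> S"
      using \<open>x \<in> S\<close> subS by (simp add: subgroup.m_closed subgroup.m_inv_closed)
    then have "?c \<in> S" using xG y by (simp add: inv_mult_group m_assoc)
    then have "p_element G p ?c"
      using K.sylow_subgroup_p_element[OF S] p_element_in_subgroup_iff[OF K] by blast
    obtain Q where Q: "sylow_subgroup G q Q"
      using sylow_subgroup_exists fin pq by blast
    have "x \<otimes> y \<otimes> inv x \<in> F"
      using xG y F.inv_op_closed2[of x y] by simp
    then have "x \<otimes> y \<otimes> inv x \<in> Q" "y \<in> Q"
      using memF[OF Q] p_element_conj[OF y(1) xG] y by auto
    moreover have "subgroup Q G" using Q by (simp add: sylow_subgroup_def)
    ultimately have "?c \<in> Q"
      by (simp add: subgroup.m_closed subgroup.m_inv_closed)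
    then have "p_element G q ?c"
      by (rule sylow_subgroup_p_element[OF Q])
    then have "?c = \<one>"
      using p_element_q_element_trivial pq \<open>p_element G p ?c\<close> by blast
    then show ?thesis using xG y commutator_trivial_iff by simp
  qed
  have subP: "subgroup P G" "finite P" "P \<subseteq> carrier G" and p: "Factorial_Ring.prime p"
    using P fin finite_subgroup subgroup.subset by (auto simp: sylow_subgroup_def)
  note N = normal_in_normalizer[OF fin subP(1)]
  show ?thesis
  proof (rule subgroup_containing_p_elements[OF fin N(1) F.is_subgroup])
    fix r f assume r: "Factorial_Ring.prime r" and f: "p_element G r f" "f \<in> F"
    show "f \<in> normalizer G P"
    proof (cases "r = p")
      case True
      then show ?thesis using memF[OF P] f N(2) by blast
    next
      case False
      have "f \<otimes> x \<otimes> inv f = x" if x: "x \<in> P" for x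
      proof -
        have "x \<otimes> f = f \<otimes> x" "x \<in> carrier G"
          using comm[OF p r _ _ f] False P x sylow_subgroup_p_element subP by auto
        then show ?thesis using f by (simp add: m_assoc flip: \<open>x \<otimes> f = f \<otimes> x\<close>)
      qed
      then show ?thesis using f subP by (simp add: normalizer_iff)
    qed
  qed
qed

theorem theorem11:
  fixes G (structure)
  assumes "group G" and "finite (carrier G)"
  shows "(nilpotent_group G \<longleftrightarrow>
            (\<forall>H. abnormal G H \<longrightarrow> R_subnormal G (gen_fitting G) H))
       \<and> (nilpotent_group G \<longleftrightarrow>
            (\<forall>p P. sylow_subgroup G p P \<longrightarrow> R_subnormal G (gen_fitting G) (normalizer G P)))
       \<and> (nilpotent_group G \<longleftrightarrow>
            (\<forall>H. cyclic_primary G H \<longrightarrow> R_subnormal G (gen_fitting G) H))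
       \<and> (nilpotent_group G \<longleftrightarrow>
            (\<forall>p P. sylow_subgroup G p P \<longrightarrow> R_subnormal G (gen_fitting G) P))"
proof -
  interpret group G by fact
  note fin = \<open>finite (carrier G)\<close>
  let ?F = "gen_fitting G"
  have F: "?F \<subseteq> carrier G"
    using normal_gen_fitting normal_imp_subgroup subgroup.subset by blast
  have subnormal: "R_subnormal G ?F H" if "nilpotent_group G" "subgroup H G" for H
    using nilpotent_group_R_subnormal[OF fin that(1) F that(2)] .
  have normalizer: "subgroup (normalizer G P) G" if "sylow_subgroup G p P" for p P
    using that normal_in_normalizer(1)[OF fin] by (simp add: sylow_subgroup_def)
  have "?F \<subseteq> normalizer G P"
    if P: "sylow_subgroup G p P" and "R_subnormal G ?F (normalizer G P)" for p P
    using that(2) subgroup.subset[OF normalizer[OF P]]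
      normalizer_sylow_subgroup_self_normalizing[OF fin P]
    by (intro R_subnormal_self_normalizing[OF F]) auto
  then have 3: "nilpotent_group G"
    if "\<forall>p P. sylow_subgroup G p P \<longrightarrow> R_subnormal G ?F (normalizer G P)"
    using that nilpotent_groupI_gen_fitting[OF fin] by metis
  have 2: "nilpotent_group G" if "\<forall>H. abnormal G H \<longrightarrow> R_subnormal G ?F H"
    using that 3 abnormal_normalizer_sylow_subgroup[OF fin] by blast
  have 4: "nilpotent_group G" if "\<forall>H. cyclic_primary G H \<longrightarrow> R_subnormal G ?F H"
    using that cyclic_primary_R_subnormal_normalizer[OF fin normal_gen_fitting]
    by (intro nilpotent_groupI_gen_fitting[OF fin]) blast
  have 5: "nilpotent_group G" if "\<forall>p P. sylow_subgroup G p P \<longrightarrow> R_subnormal G ?F P"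
    using that sylow_R_subnormal_normalizer[OF fin _ F]
    by (intro nilpotent_groupI_gen_fitting[OF fin]) blast
  have "subgroup H G" if "cyclic_primary G H" for H
    using that generate_is_subgroup by (auto simp: cyclic_primary_def)
  moreover have "subgroup H G" if "abnormal G H" for H
    using that by (simp add: abnormal_def)
  moreover have "subgroup P G" if "sylow_subgroup G p P" for p P
    using that by (simp add: sylow_subgroup_def)
  ultimately show ?thesis
    using 2 3 4 5 subnormal normalizer by metis
qed

end
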